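(* Let $D$ be a skew field which is finite-dimensional over its center $C(D)$, $\sigma$ an automorphism of $D$ of finite order, and $R=D[X;\sigma]$. Let $D^\sigma$ be the skew subfield of $\sigma$-invariants, $K=C(D)\cap D^\sigma$, $\mu=\dim_K D$ (which is finite), and let $r$ be the rank of $R$ as a (free) module over its center, with $\{c_1,\dots,c_r\}$ a fixed set of generators of $R$ as a module over its center. Let $f\in R$ be nonzero and $n=\deg f$. Then the number of basic operations in $K$ needed to run Algorithm B (described in the context) on $f$, which computes a bound of $f$, belongs to $$\mathcal{O}\big(rn\,\mathrm{I}(\mu)+r^3n^2\,\mathrm{S}(\mu)+r^2n^2(\mathrm{M}(\mu)+\mathrm{A}(\mu))\big).$$
   Context: $R=D[X;\sigma]$ is the skew polynomial ring: left $D$-basis $\{X^n:n\ge0\}$ and $Xa=\sigma(a)X$ for $a\in D$. A bound of $f$ is a polynomial $f^*$ with $Rf^*=f^*R=\operatorname{Ann}_R(R/Rf)$ (the largest twosided ideal contained in $Rf$). Cost model. $\mathrm{S}(\mu),\mathrm{M}(\mu),\mathrm{I}(\mu),\mathrm{A}(\mu)$ denote upper bounds for the number of basic operations in $K$ needed to perform in $D$, respectively, one addition, one multiplication, one inversion, and one evaluation $\sigma^i(a)$ of any power of $\sigma$ (a common bound for all $i$). Polynomial multiplication and left division with remainder in $R$ are the classical (schoolbook) ones. The asymptotics are in $n$; the ring $R$ and the generators $c_i$ are fixed, and the degrees of the $c_i$ are treated as constants. Algorithm A (annihilator of an element). Given nonzero $f,h\in R$, compute $v$ with $Rv=\operatorname{Ann}_R(h+Rf)=\{g: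 gh\in Rf\}$ by the extended Euclidean algorithm keeping only one cofactor: set $v_1\leftarrow1$, $v_0\leftarrow0$, $f_0\leftarrow f$, $f_1\leftarrow h$; perform the following step once, and then repeat it while $f_1\ne0$: write $f_0=cf_1+\rho$ with $\deg\rho<\deg f_1$, set $f_0\leftarrow f_1$, $f_1\leftarrow\rho$, $v\leftarrow v_0-cv_1$, $v_0\leftarrow v_1$, $v_1\leftarrow v$. Return $v_1$. The left least common multiple $[f,h]_\ell$ (generator of $Rf\cap Rh$) is computed as $vh$ with $v$ the output of Algorithm A. Algorithm B (computation of a bound). Input: $f\neq0$ and $c_1,\dots,c_r$. Set $g\leftarrow f$; for $i=1,\dots,r$: compute by Algorithm A a generator $f_{c_i}$ of $\operatorname{Ann}_R(c_i+Rf)$ and set $g\leftarrow[f_{c_i},g]_\ell$. Return $g$. *)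

theory Defs
  imports
    Complex_Main
    "HOL-Computational_Algebra.Polynomial"
    "HOL-Library.FuncSet"
    "HOL-Library.Monad_Syntax"
    "HOL-Library.While_Combinator"
begin

section \<open>Modules over a central subring\<close>

text \<open>
  The multiplication is a parameter, so that the same notions apply to \<open>D\<close> (a type of class
  \<^class>\<open>division_ring\<close>) and to \<open>R = D[X;\<sigma>]\<close>, whose multiplication is not that of the
  type \<open>'a poly\<close>.
\<close>

definition center :: "('r \<Rightarrow> 'r \<Rightarrow> 'r) \<Rightarrow> 'r set" where
  "center mul = {z. \<forall>x. mul z x = mul x z}"

definition module_basis :: "('r::comm_monoid_add \<Rightarrow> 'r \<Rightarrow> 'r) \<Rightarrow> 'r set \<Rightarrow> 'r set \<Rightarrow> bool" where
  "module_basis mul Z B \<longleftrightarrow>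
     finite B \<and> (\<forall>x. \<exists>!k. k \<in> B \<rightarrow>\<^sub>E Z \<and> x = (\<Sum>b\<in>B. mul (k b) b))"

definition has_rank :: "('r::comm_monoid_add \<Rightarrow> 'r \<Rightarrow> 'r) \<Rightarrow> 'r set \<Rightarrow> nat \<Rightarrow> bool" where
  "has_rank mul Z r \<longleftrightarrow> (\<exists>B. module_basis mul Z B \<and> card B = r)"

definition module_generators :: "('r::comm_monoid_add \<Rightarrow> 'r \<Rightarrow> 'r) \<Rightarrow> 'r set \<Rightarrow> 'r list \<Rightarrow> bool" where
  "module_generators mul Z cs \<longleftrightarrow>
     (\<forall>x. \<exists>k. (\<forall>i<length cs. k i \<in> Z) \<and> x = (\<Sum>i<length cs. mul (k i) (cs ! i)))"

section \<open>The skew polynomial ring\<close>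

definition ring_automorphism :: "('a::ring_1 \<Rightarrow> 'a) \<Rightarrow> bool" where
  "ring_automorphism \<sigma> \<longleftrightarrow>
     bij \<sigma> \<and> \<sigma> 1 = 1 \<and> (\<forall>x y. \<sigma> (x + y) = \<sigma> x + \<sigma> y) \<and> (\<forall>x y. \<sigma> (x * y) = \<sigma> x * \<sigma> y)"

definition finite_order :: "('a \<Rightarrow> 'a) \<Rightarrow> bool" where
  "finite_order \<sigma> \<longleftrightarrow> (\<exists>m>0. \<sigma> ^^ m = id)"

definition invariants :: "('a \<Rightarrow> 'a) \<Rightarrow> 'a set" where
  "invariants \<sigma> = {a. \<sigma> a = a}"

text \<open>
  The additive group of \<open>D[X;\<sigma>]\<close> is that of \<open>'a poly\<close>, with coefficients on the left; the
  multiplication is determined by \<open>(a X^i)(b X^j) = a \<sigma>^i(b) X^(i+j)\<close>.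
\<close>

definition skew_mult :: "('a::division_ring \<Rightarrow> 'a) \<Rightarrow> 'a poly \<Rightarrow> 'a poly \<Rightarrow> 'a poly" where
  "skew_mult \<sigma> f g =
     (\<Sum>i\<le>degree f. \<Sum>j\<le>degree g. monom (coeff f i * (\<sigma> ^^ i) (coeff g j)) (i + j))"

definition left_multiples :: "('a::division_ring \<Rightarrow> 'a) \<Rightarrow> 'a poly \<Rightarrow> 'a poly set" where
  "left_multiples \<sigma> f = {skew_mult \<sigma> q f | q. True}"

definition right_multiples :: "('a::division_ring \<Rightarrow> 'a) \<Rightarrow> 'a poly \<Rightarrow> 'a poly set" where
  "right_multiples \<sigma> f = {skew_mult \<sigma> f q | q. True}"

text \<open>The annihilator of the left \<open>R\<close>-module \<open>R/Rf\<close>.\<close>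

definition quotient_annihilator :: "('a::division_ring \<Rightarrow> 'a) \<Rightarrow> 'a poly \<Rightarrow> 'a poly set" where
  "quotient_annihilator \<sigma> f = {g. \<forall>h. skew_mult \<sigma> g h \<in> left_multiples \<sigma> f}"

definition is_bound :: "('a::division_ring \<Rightarrow> 'a) \<Rightarrow> 'a poly \<Rightarrow> 'a poly \<Rightarrow> bool" where
  "is_bound \<sigma> f b \<longleftrightarrow>
     left_multiples \<sigma> b = right_multiples \<sigma> b \<and> left_multiples \<sigma> b = quotient_annihilator \<sigma> f"

section \<open>Cost of the arithmetic of \<open>D\<close>\<close>

text \<open>
  Numbers of basic operations in \<open>K\<close> spent on the addition \<open>a + b\<close>, the multiplication
  \<open>a * b\<close>, the inversion of \<open>a\<close> and the evaluation of \<open>(\<sigma> ^^ i) a\<close>. They may depend on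
  the operands. A subtraction \<open>a - b\<close> is charged as the addition \<open>a + (- b)\<close>; a change of sign,
  a test for zero and the inspection of a degree are not charged.
\<close>

record 'a op_costs =
  add_cost :: "'a \<Rightarrow> 'a \<Rightarrow> nat"
  mult_cost :: "'a \<Rightarrow> 'a \<Rightarrow> nat"
  inv_cost :: "'a \<Rightarrow> nat"
  aut_cost :: "nat \<Rightarrow> 'a \<Rightarrow> nat"

definition costs_bounded_by :: "'a::zero op_costs \<Rightarrow> nat \<Rightarrow> nat \<Rightarrow> nat \<Rightarrow> nat \<Rightarrow> bool" where
  "costs_bounded_by \<kappa> s m i a \<longleftrightarrow>
     (\<forall>x y. add_cost \<kappa> x y \<le> s) \<and> (\<forall>x y. mult_cost \<kappa> x y \<le> m) \<and>
     (\<forall>x. x \<noteq> 0 \<longrightarrow> inv_cost \<kappa> x \<le> i) \<and> (\<forall>j x. aut_cost \<kappa> j x \<le> a)"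

section \<open>Schoolbook arithmetic with operation counts\<close>

text \<open>
  Every function below returns its result together with the number of basic operations in \<open>K\<close>
  spent. Coefficient lists are dense, constant coefficient first.
\<close>

text \<open>The coefficients of \<open>(a X^i) g\<close>, divided on the right by \<open>X^i\<close>.\<close>

fun scaled_row :: "('a::division_ring \<Rightarrow> 'a) \<Rightarrow> 'a op_costs \<Rightarrow> 'a \<Rightarrow> nat \<Rightarrow> 'a list \<Rightarrow> 'a list \<times> nat" where
  "scaled_row \<sigma> \<kappa> a i [] = ([], 0)"
| "scaled_row \<sigma> \<kappa> a i (b # bs) =
     (let b' = (\<sigma> ^^ i) b;
          (row, t) = scaled_row \<sigma> \<kappa> a i bs
      in ((a * b') # row, aut_cost \<kappa> i b + mult_cost \<kappa> a b' + t))"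

text \<open>Addition of \<open>xs\<close> and \<open>X^i ys\<close>; only overlapping coefficients are added.\<close>

fun shifted_add :: "'a::division_ring op_costs \<Rightarrow> nat \<Rightarrow> 'a list \<Rightarrow> 'a list \<Rightarrow> 'a list \<times> nat" where
  "shifted_add \<kappa> (Suc i) [] ys = (let (zs, t) = shifted_add \<kappa> i [] ys in (0 # zs, t))"
| "shifted_add \<kappa> (Suc i) (x # xs) ys = (let (zs, t) = shifted_add \<kappa> i xs ys in (x # zs, t))"
| "shifted_add \<kappa> 0 [] ys = (ys, 0)"
| "shifted_add \<kappa> 0 (x # xs) [] = (x # xs, 0)"
| "shifted_add \<kappa> 0 (x # xs) (y # ys) =
     (let (zs, t) = shifted_add \<kappa> 0 xs ys in ((x + y) # zs, add_cost \<kappa> x y + t))"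

definition poly_add :: "'a::division_ring op_costs \<Rightarrow> 'a poly \<Rightarrow> 'a poly \<Rightarrow> 'a poly \<times> nat" where
  "poly_add \<kappa> f g = (let (zs, t) = shifted_add \<kappa> 0 (coeffs f) (coeffs g) in (Poly zs, t))"

text \<open>\<open>p + (a X^i) g\<close>, the common step of multiplication and division.\<close>

definition add_scaled ::
    "('a::division_ring \<Rightarrow> 'a) \<Rightarrow> 'a op_costs \<Rightarrow> 'a poly \<Rightarrow> 'a \<Rightarrow> nat \<Rightarrow> 'a poly \<Rightarrow> 'a poly \<times> nat" where
  "add_scaled \<sigma> \<kappa> p a i g =
     (let (row, t) = scaled_row \<sigma> \<kappa> a i (coeffs g);
          (zs, t') = shifted_add \<kappa> i (coeffs p) row
      in (Poly zs, t + t'))"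

fun mult_loop ::
    "('a::division_ring \<Rightarrow> 'a) \<Rightarrow> 'a op_costs \<Rightarrow> 'a poly \<Rightarrow> nat \<Rightarrow> 'a list \<Rightarrow> 'a poly \<Rightarrow> 'a poly \<times> nat" where
  "mult_loop \<sigma> \<kappa> acc i [] g = (acc, 0)"
| "mult_loop \<sigma> \<kappa> acc i (a # as) g =
     (let (acc', t) = add_scaled \<sigma> \<kappa> acc a i g;
          (p, t') = mult_loop \<sigma> \<kappa> acc' (Suc i) as g
      in (p, t + t'))"

definition poly_mult ::
    "('a::division_ring \<Rightarrow> 'a) \<Rightarrow> 'a op_costs \<Rightarrow> 'a poly \<Rightarrow> 'a poly \<Rightarrow> 'a poly \<times> nat" where
  "poly_mult \<sigma> \<kappa> f g = mult_loop \<sigma> \<kappa> 0 0 (coeffs f) g"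

text \<open>
  Left division \<open>f = c g + \<rho>\<close>. The leading coefficient of \<open>g\<close> is inverted once, giving \<open>u\<close>; the
  coefficient of \<open>X^i\<close> in the quotient is then \<open>a \<sigma>^i(u)\<close> with \<open>a\<close> the coefficient of
  \<open>X^(deg g + i)\<close> in the current dividend. The counter runs one above the exponent \<open>i\<close>.
\<close>

fun div_loop ::
    "('a::division_ring \<Rightarrow> 'a) \<Rightarrow> 'a op_costs \<Rightarrow> 'a \<Rightarrow> 'a poly \<Rightarrow> nat \<Rightarrow> 'a poly \<Rightarrow>
     ('a poly \<times> 'a poly) \<times> nat" where
  "div_loop \<sigma> \<kappa> u g 0 f = ((0, f), 0)"
| "div_loop \<sigma> \<kappa> u g (Suc i) f =
     (let a = coeff f (degree g + i);
          u' = (\<sigma> ^^ i) u;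
          c = a * u';
          (f', t) = add_scaled \<sigma> \<kappa> f (- c) i g;
          ((q, \<rho>), t') = div_loop \<sigma> \<kappa> u g i f'
      in ((monom c i + q, \<rho>), aut_cost \<kappa> i u + mult_cost \<kappa> a u' + t + t'))"

definition poly_div ::
    "('a::division_ring \<Rightarrow> 'a) \<Rightarrow> 'a op_costs \<Rightarrow> 'a poly \<Rightarrow> 'a poly \<Rightarrow> ('a poly \<times> 'a poly) \<times> nat" where
  "poly_div \<sigma> \<kappa> f g =
     (if degree f < degree g then ((0, f), 0)
      else let b = lead_coeff g;
               (res, t) = div_loop \<sigma> \<kappa> (inverse b) g (Suc (degree f - degree g)) f
           in (res, inv_cost \<kappa> b + t))"

section \<open>The algorithms\<close>

text \<open>
  The last component of the state below, \<open>(f\<^sub>0, f\<^sub>1, v\<^sub>0, v\<^sub>1, t)\<close>, accumulates the cost.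
\<close>

type_synonym 'a euclid_state = "'a poly \<times> 'a poly \<times> 'a poly \<times> 'a poly \<times> nat"

fun euclid_step :: "('a::division_ring \<Rightarrow> 'a) \<Rightarrow> 'a op_costs \<Rightarrow> 'a euclid_state \<Rightarrow> 'a euclid_state" where
  "euclid_step \<sigma> \<kappa> (f0, f1, v0, v1, t) =
     (let ((c, \<rho>), t1) = poly_div \<sigma> \<kappa> f0 f1;
          (p, t2) = poly_mult \<sigma> \<kappa> c v1;
          (v, t3) = poly_add \<kappa> v0 (- p)
      in (f1, \<rho>, v1, v, t + t1 + t2 + t3))"

text \<open>
  A generator of the annihilator of \<open>h + Rf\<close>. The step is performed once before the loop
  condition is tested; the result is \<open>None\<close> iff the loop does not terminate.
\<close>

definition element_annihilator ::
    "('a::division_ring \<Rightarrow> 'a) \<Rightarrow> 'a op_costs \<Rightarrow> 'a poly \<Rightarrow> 'a poly \<Rightarrow> ('a poly \<times> nat) option" where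
  "element_annihilator \<sigma> \<kappa> f h =
     map_option (\<lambda>(f0, f1, v0, v1, t). (v1, t))
       (while_option (\<lambda>(f0, f1, v0, v1, t). f1 \<noteq> 0) (euclid_step \<sigma> \<kappa>)
         (euclid_step \<sigma> \<kappa> (f, h, 0, [:1:], 0)))"

definition left_lcm ::
    "('a::division_ring \<Rightarrow> 'a) \<Rightarrow> 'a op_costs \<Rightarrow> 'a poly \<Rightarrow> 'a poly \<Rightarrow> ('a poly \<times> nat) option" where
  "left_lcm \<sigma> \<kappa> f h =
     do { (v, t) \<leftarrow> element_annihilator \<sigma> \<kappa> f h;
          let (m, t') = poly_mult \<sigma> \<kappa> v h;
          Some (m, t + t') }"

fun bound_loop ::
    "('a::division_ring \<Rightarrow> 'a) \<Rightarrow> 'a op_costs \<Rightarrow> 'a poly \<Rightarrow> 'a poly list \<Rightarrow> 'a poly \<Rightarrow>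
     ('a poly \<times> nat) option" where
  "bound_loop \<sigma> \<kappa> f [] g = Some (g, 0)"
| "bound_loop \<sigma> \<kappa> f (c # cs) g =
     do { (fc, t1) \<leftarrow> element_annihilator \<sigma> \<kappa> f c;
          (g', t2) \<leftarrow> left_lcm \<sigma> \<kappa> fc g;
          (b, t3) \<leftarrow> bound_loop \<sigma> \<kappa> f cs g';
          Some (b, t1 + t2 + t3) }"

definition compute_bound ::
    "('a::division_ring \<Rightarrow> 'a) \<Rightarrow> 'a op_costs \<Rightarrow> 'a poly list \<Rightarrow> 'a poly \<Rightarrow> ('a poly \<times> nat) option" where
  "compute_bound \<sigma> \<kappa> cs f = bound_loop \<sigma> \<kappa> f cs f"

end

theory Submission
  imports Defs
begin

text \<open>
  The cost estimate rests on two observations. In the Euclidean algorithm on \<open>f, h\<close> every division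
  step costs, apart from one inversion, \<open>O(deg f)\<close> operations per unit by which it lowers the degree
  of \<open>f\<^sub>0\<close>, and after at most two steps \<open>f\<^sub>0\<close> is no longer than the shorter of the two inputs;
  hence Algorithm A takes \<open>O(deg f \<sqdot> deg h)\<close> additions, multiplications and evaluations of \<open>\<sigma>\<close>, but
  only \<open>deg f + 1\<close> inversions. In Algorithm B, each \<open>f\<^sub>c\<close> has degree at most \<open>n\<close> and the running
  multiple \<open>g\<close> degree at most \<open>(r + 1) n\<close>.

  The output generates \<open>Ann(R/Rf)\<close> because the \<open>c\<^sub>i\<close> generate \<open>R\<close> over its center. As there are
  only \<open>r\<close> of them and \<open>R\<close> is free of rank \<open>r\<close>, none of them is zero, so that Algorithm A never
  divides by zero.
\<close>

section \<open>Linear dependence over a central subring\<close>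

text \<open>The multiplication is a parameter because two instances are needed: \<open>D\<close>
  with its own product, and \<open>R\<close> with \<open>skew_mult \<sigma>\<close>, which is not
  the product of the type \<open>'a poly\<close>.\<close>

locale mult_domain =
  fixes mul :: "'r::ab_group_add \<Rightarrow> 'r \<Rightarrow> 'r" (infixl "\<odot>" 70)
    and one :: 'r
  assumes assoc: "(x \<odot> y) \<odot> z = x \<odot> (y \<odot> z)"
    and distrib_left: "x \<odot> (y + z) = x \<odot> y + x \<odot> z"
    and distrib_right: "(x + y) \<odot> z = x \<odot> z + y \<odot> z"
    and one_left: "one \<odot> x = x"
    and one_right: "x \<odot> one = x"
    and no_zero_div: "x \<odot> y = 0 \<Longrightarrow> x = 0 \<or> y = 0"
    and one_neq_zero: "one \<noteq> 0"
begin

lemma zero_left [simp]: "0 \<odot> x = 0"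
  using distrib_right[of 0 0 x] by simp

lemma zero_right [simp]: "x \<odot> 0 = 0"
  using distrib_left[of x 0 0] by simp

lemma minus_left: "(- x) \<odot> y = - (x \<odot> y)"
  using distrib_right[of x "- x" y] by (simp add: minus_unique)

lemma minus_right: "x \<odot> (- y) = - (x \<odot> y)"
  using distrib_left[of x y "- y"] by (simp add: minus_unique)

lemma diff_left: "(x - y) \<odot> z = x \<odot> z - y \<odot> z"
  using distrib_right[of x "- y" z] by (simp add: minus_left)

lemma diff_right: "x \<odot> (y - z) = x \<odot> y - x \<odot> z"
  using distrib_left[of x y "- z"] by (simp add: minus_right)

lemma sum_left: "(\<Sum>i\<in>I. f i) \<odot> x = (\<Sum>i\<in>I. f i \<odot> x)"
  by (induction I rule: infinite_finite_induct) (simp_all add: distrib_right)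

lemma sum_right: "x \<odot> (\<Sum>i\<in>I. f i) = (\<Sum>i\<in>I. x \<odot> f i)"
  by (induction I rule: infinite_finite_induct) (simp_all add: distrib_left)

lemma right_cancel: "x \<odot> z = y \<odot> z \<Longrightarrow> z \<noteq> 0 \<Longrightarrow> x = y"
  using no_zero_div[of "x - y" z] by (simp add: diff_left)

text \<open>General enough for both the full center of \<open>R\<close> and the field
  \<open>K\<close>, which may be smaller than the center of \<open>D\<close>.\<close>

definition central_subring :: "'r set \<Rightarrow> bool" where
  "central_subring Z \<longleftrightarrow> Z \<subseteq> center (\<odot>) \<and> 0 \<in> Z \<and> one \<in> Z \<and>
     (\<forall>x\<in>Z. \<forall>y\<in>Z. x + y \<in> Z \<and> x - y \<in> Z \<and> x \<odot> y \<in> Z)"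

lemma central_subring_center: "central_subring (center (\<odot>))"
proof -
  have "x \<odot> y \<in> center (\<odot>)" if "x \<in> center (\<odot>)" "y \<in> center (\<odot>)" for x y
    using that unfolding center_def mem_Collect_eq by (metis assoc)
  moreover have "x + y \<in> center (\<odot>)" "x - y \<in> center (\<odot>)"
    if "x \<in> center (\<odot>)" "y \<in> center (\<odot>)" for x y
    using that by (auto simp: center_def distrib_left distrib_right diff_left diff_right)
  moreover have "0 \<in> center (\<odot>)" "one \<in> center (\<odot>)"
    by (simp_all add: center_def one_left one_right)
  ultimately show ?thesis
    by (simp add: central_subring_def)
qed

lemma central_commute: "central_subring Z \<Longrightarrow> z \<in> Z \<Longrightarrow> z \<odot> x = x \<odot> z"
  unfolding central_subring_def center_def by blast

lemma central_sum_mem: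
  assumes "central_subring Z" "\<And>i. i \<in> I \<Longrightarrow> f i \<in> Z"
  shows "(\<Sum>i\<in>I. f i) \<in> Z"
  using assms(2)
  by (induction I rule: infinite_finite_induct) (use assms(1) in \<open>auto simp: central_subring_def\<close>)

text \<open>Gaussian elimination without division: rows are cross-multiplied by the pivot, and the
  absence of zero divisors keeps the resulting relation nontrivial.\<close>

lemma dependent_rows:
  assumes Z: "central_subring Z" and "finite I" "finite J" "card I < card J"
    and "\<And>j i. j \<in> J \<Longrightarrow> i \<in> I \<Longrightarrow> a j i \<in> Z"
  shows "\<exists>x. (\<forall>j\<in>J. x j \<in> Z) \<and> (\<exists>j\<in>J. x j \<noteq> 0) \<and> (\<forall>i\<in>I. (\<Sum>j\<in>J. x j \<odot> a j i) = 0)"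
  using assms(2-)
proof (induction I arbitrary: J a rule: finite_induct)
  case empty
  then have "J \<noteq> {}" by auto
  moreover have "one \<in> Z" using Z by (simp add: central_subring_def)
  ultimately show ?case using one_neq_zero by (intro exI[of _ "\<lambda>_. one"]) auto
next
  case (insert l I)
  note closed = Z[unfolded central_subring_def]
  show ?case
  proof (cases "\<forall>j\<in>J. a j l = 0")
    case True
    have "\<exists>x. (\<forall>j\<in>J. x j \<in> Z) \<and> (\<exists>j\<in>J. x j \<noteq> 0) \<and> (\<forall>i\<in>I. (\<Sum>j\<in>J. x j \<odot> a j i) = 0)"
      by (rule insert.IH) (use insert in auto)
    moreover have "(\<Sum>j\<in>J. x j \<odot> a j l) = 0" for x using True by simp
    ultimately show ?thesis by blast
  next
    case False
    then obtain p where p: "p \<in> J" "a p l \<noteq> 0" by auto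
    define J' where "J' = J - {p}"
    have J: "J = insert p J'" "p \<notin> J'" "finite J'" using p insert.prems(1) by (auto simp: J'_def)
    have aZ: "a j i \<in> Z" if "j \<in> J" "i \<in> insert l I" for j i using insert.prems that by auto
    \<comment> \<open>These combinations vanish in column \<open>l\<close>, so the pivot row and
      that column drop out of the system.\<close>
    define b where "b j i = a p l \<odot> a j i - a j l \<odot> a p i" for j i
    have "\<exists>x. (\<forall>j\<in>J'. x j \<in> Z) \<and> (\<exists>j\<in>J'. x j \<noteq> 0) \<and> (\<forall>i\<in>I. (\<Sum>j\<in>J'. x j \<odot> b j i) = 0)"
    proof (rule insert.IH)
      show "card I < card J'" using insert.prems(2) insert.hyps J by simp
      show "b j i \<in> Z" if "j \<in> J'" "i \<in> I" for j i
        using closed aZ[of p l] aZ[of j i] aZ[of j l] aZ[of p i] that p(1) J(1) by (simp add: b_def)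
    qed fact
    then obtain x where x: "\<forall>j\<in>J'. x j \<in> Z" "\<exists>j\<in>J'. x j \<noteq> 0"
      "\<And>i. i \<in> I \<Longrightarrow> (\<Sum>j\<in>J'. x j \<odot> b j i) = 0" by blast
    define s where "s = (\<Sum>j\<in>J'. x j \<odot> a j l)"
    \<comment> \<open>The coefficient \<open>- s\<close> of the pivot row collects the multiples
      subtracted in \<open>b\<close>, which makes the \<open>y\<close>-combination of the rows of
      \<open>a\<close> equal to the \<open>x\<close>-combination of the rows of
      \<open>b\<close>.\<close>
    define y where "y j = (if j = p then - s else x j \<odot> a p l)" for j
    have "s \<in> Z" unfolding s_def
      by (rule central_sum_mem[OF Z]) (use closed x(1) aZ J in auto)
    then have "- s \<in> Z" using closed by (metis diff_0)
    then have yZ: "\<forall>j\<in>J. y j \<in> Z"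
      using x(1) closed aZ p(1) J by (auto simp: y_def)
    obtain q where q: "q \<in> J'" "x q \<noteq> 0" using x(2) by auto
    then have "y q \<noteq> 0" using J(2) p(2) no_zero_div by (auto simp: y_def)
    have yJ': "(\<Sum>j\<in>J'. y j \<odot> a j i) = (\<Sum>j\<in>J'. x j \<odot> (a p l \<odot> a j i))" for i
      by (rule sum.cong) (use J(2) in \<open>auto simp: y_def assoc\<close>)
    have "(\<Sum>j\<in>J. y j \<odot> a j i) = 0" if i: "i \<in> insert l I" for i
    proof -
      have "(\<Sum>j\<in>J. y j \<odot> a j i) = (\<Sum>j\<in>J'. x j \<odot> (a p l \<odot> a j i)) - s \<odot> a p i"
        using J yJ' by (simp add: y_def minus_left)
      also have "\<dots> = (\<Sum>j\<in>J'. x j \<odot> b j i)"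
        by (simp add: b_def s_def sum_left diff_right sum_subtractf assoc)
      also have "\<dots> = 0"
      proof (cases "i = l")
        case True
        \<comment> \<open>The induction hypothesis says nothing about column \<open>l\<close>; there
          the entries of \<open>b\<close> vanish because elements of \<open>Z\<close>
          commute.\<close>
        then have "b j i = 0" if "j \<in> J'" for j
          using central_commute[OF Z, of "a p l" "a j l"] aZ p(1) by (simp add: b_def)
        then show ?thesis by simp
      qed (use i x(3) in auto)
      finally show ?thesis .
    qed
    then show ?thesis using yZ q(1) \<open>y q \<noteq> 0\<close> J(1) by blast
  qed
qed

text \<open>Write each \<open>w j\<close> in terms of the \<open>v i\<close>; a relation between the
  rows of the coefficient matrix kills every coefficient.\<close>

lemma dependent_of_span:
  assumes Z: "central_subring Z" and fin: "finite I" "finite J" "card I < card J"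
    and w: "\<And>j. j \<in> J \<Longrightarrow> \<exists>k. (\<forall>i\<in>I. k i \<in> Z) \<and> w j = (\<Sum>i\<in>I. k i \<odot> v i)"
  shows "\<exists>x. (\<forall>j\<in>J. x j \<in> Z) \<and> (\<exists>j\<in>J. x j \<noteq> 0) \<and> (\<Sum>j\<in>J. x j \<odot> w j) = 0"
proof -
  obtain a where a: "\<And>j i. j \<in> J \<Longrightarrow> i \<in> I \<Longrightarrow> a j i \<in> Z"
    "\<And>j. j \<in> J \<Longrightarrow> w j = (\<Sum>i\<in>I. a j i \<odot> v i)"
    using w by metis
  obtain x where x: "\<forall>j\<in>J. x j \<in> Z" "\<exists>j\<in>J. x j \<noteq> 0" "\<And>i. i \<in> I \<Longrightarrow> (\<Sum>j\<in>J. x j \<odot> a j i) = 0"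
    using dependent_rows[OF Z fin, of a] a(1) by blast
  have "(\<Sum>j\<in>J. x j \<odot> w j) = (\<Sum>j\<in>J. \<Sum>i\<in>I. (x j \<odot> a j i) \<odot> v i)"
    by (rule sum.cong) (simp_all add: a(2) sum_right assoc)
  also have "\<dots> = (\<Sum>i\<in>I. (\<Sum>j\<in>J. x j \<odot> a j i) \<odot> v i)"
    unfolding sum_left by (rule sum.swap)
  also have "\<dots> = 0" using x(3) by simp
  finally show ?thesis using x by blast
qed

section \<open>Bases, generating systems and injective linear maps\<close>

lemma basis_independent:
  assumes Z: "central_subring Z" and B: "module_basis (\<odot>) Z B"
    and k: "\<And>b. b \<in> B \<Longrightarrow> k b \<in> Z" "(\<Sum>b\<in>B. k b \<odot> b) = 0" and "b \<in> B"
  shows "k b = 0"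
proof -
  have "\<exists>!k. k \<in> B \<rightarrow>\<^sub>E Z \<and> 0 = (\<Sum>b\<in>B. k b \<odot> b)"
    using B unfolding module_basis_def by blast
  \<comment> \<open>\<open>module_basis\<close> asserts uniqueness among extensional functions only,
    so both representations of 0 are restricted to \<open>B\<close> before they are
    compared.\<close>
  moreover have "restrict k B \<in> B \<rightarrow>\<^sub>E Z \<and> 0 = (\<Sum>b\<in>B. restrict k B b \<odot> b)"
    using k by (auto simp: restrict_def)
  moreover have "restrict (\<lambda>_. 0) B \<in> B \<rightarrow>\<^sub>E Z \<and> 0 = (\<Sum>b\<in>B. restrict (\<lambda>_. 0) B b \<odot> b)"
    using Z by (auto simp: central_subring_def)
  ultimately have "restrict k B = restrict (\<lambda>_. 0) B" by blast
  then show ?thesis using \<open>b \<in> B\<close> by (metis restrict_apply')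
qed

text \<open>A zero among the generators could be dropped, and the fewer remaining ones would force a
  relation between the elements of a basis.\<close>

lemma generators_nonzero:
  assumes Z: "central_subring Z" and "has_rank (\<odot>) Z (length cs)" "module_generators (\<odot>) Z cs"
    and c: "c \<in> set cs"
  shows "c \<noteq> 0"
proof
  assume "c = 0"
  then obtain p where p: "p < length cs" "cs ! p = 0" using c by (auto simp: in_set_conv_nth)
  obtain B where B: "module_basis (\<odot>) Z B" "card B = length cs" "finite B"
    using assms(2) by (auto simp: has_rank_def module_basis_def)
  have "\<exists>x. (\<forall>b\<in>B. x b \<in> Z) \<and> (\<exists>b\<in>B. x b \<noteq> 0) \<and> (\<Sum>b\<in>B. x b \<odot> b) = 0"
  proof (rule dependent_of_span[OF Z, where I = "{..<length cs} - {p}" and v = "(!) cs"])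
    fix b assume "b \<in> B"
    obtain k where k: "\<forall>i<length cs. k i \<in> Z" "b = (\<Sum>i<length cs. k i \<odot> (cs ! i))"
      using assms(3) unfolding module_generators_def by blast
    then have "b = (\<Sum>i\<in>{..<length cs} - {p}. k i \<odot> (cs ! i))"
      using p by (simp add: sum.remove[of _ p])
    then show "\<exists>k. (\<forall>i\<in>{..<length cs} - {p}. k i \<in> Z) \<and>
        b = (\<Sum>i\<in>{..<length cs} - {p}. k i \<odot> (cs ! i))"
      using k(1) by auto
  next
    show "card ({..<length cs} - {p}) < card B" using p B(2) by simp
  qed (use B in auto)
  then show False using basis_independent[OF Z B(1)] by blast
qed

text \<open>The images of a basis together with \<open>y\<close> are one vector too many, hence
  dependent. Injectivity makes the coefficient of \<open>y\<close> nonzero, and dividing by it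
  exhibits a preimage.\<close>

lemma injective_linear_imp_surjective:
  assumes Z: "central_subring Z" and inv: "\<And>k. k \<in> Z \<Longrightarrow> k \<noteq> 0 \<Longrightarrow> \<exists>l\<in>Z. l \<odot> k = one"
    and "has_rank (\<odot>) Z m"
    and add: "\<And>x y. \<phi> (x + y) = \<phi> x + \<phi> y"
    and scale: "\<And>k x. k \<in> Z \<Longrightarrow> \<phi> (k \<odot> x) = k \<odot> \<phi> x"
    and inj: "\<And>x. \<phi> x = 0 \<Longrightarrow> x = 0"
  shows "\<exists>x. \<phi> x = y"
proof -
  obtain B where B: "module_basis (\<odot>) Z B" "finite B"
    using assms(3) by (auto simp: has_rank_def module_basis_def)
  have [simp]: "\<phi> 0 = 0" using add[of 0 0] by simp
  have sum: "\<phi> (\<Sum>b\<in>B. k b \<odot> b) = (\<Sum>b\<in>B. k b \<odot> \<phi> b)" if "\<forall>b\<in>B. k b \<in> Z" for k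
    using B(2) that by (induction B) (simp_all add: add scale)
  define w where "w = case_option y \<phi>"
  \<comment> \<open>The index type \<open>option\<close> keeps \<open>y\<close> apart from the
    images \<open>\<phi> b\<close> even if it equals one of them.\<close>
  define J where "J = insert None (Some ` B)"
  have "\<exists>x. (\<forall>j\<in>J. x j \<in> Z) \<and> (\<exists>j\<in>J. x j \<noteq> 0) \<and> (\<Sum>j\<in>J. x j \<odot> w j) = 0"
  proof (rule dependent_of_span[OF Z, where I = B and v = id])
    show "card B < card J" using B(2) by (auto simp: J_def card_image)
    show "\<exists>k. (\<forall>i\<in>B. k i \<in> Z) \<and> w j = (\<Sum>i\<in>B. k i \<odot> id i)" for j
      using B(1) by (force simp: module_basis_def)
  qed (use B in \<open>auto simp: J_def\<close>)
  then obtain x where x: "\<forall>j\<in>J. x j \<in> Z" "\<exists>j\<in>J. x j \<noteq> 0" "(\<Sum>j\<in>J. x j \<odot> w j) = 0" by blast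
  have xB: "\<forall>b\<in>B. x (Some b) \<in> Z" and xN: "x None \<in> Z" using x(1) by (auto simp: J_def)
  have rel: "x None \<odot> y + \<phi> (\<Sum>b\<in>B. x (Some b) \<odot> b) = 0"
    using x(3) B(2) by (simp add: J_def w_def sum[OF xB] sum.reindex)
  have "x None \<noteq> 0"
  proof
    assume 0: "x None = 0"
    then have "(\<Sum>b\<in>B. x (Some b) \<odot> b) = 0" using rel inj by simp
    then have "\<forall>b\<in>B. x (Some b) = 0"
      using basis_independent[OF Z B(1), of "\<lambda>b. x (Some b)"] xB by blast
    then show False using 0 x(2) by (auto simp: J_def)
  qed
  then obtain l where l: "l \<in> Z" "l \<odot> x None = one" using inv xN by blast
  have l': "0 - l \<in> Z" using l Z by (auto simp: central_subring_def)
  have "\<phi> ((0 - l) \<odot> (\<Sum>b\<in>B. x (Some b) \<odot> b)) = (0 - l) \<odot> - (x None \<odot> y)"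
    unfolding scale[OF l'] minus_unique[OF rel] ..
  also have "\<dots> = (l \<odot> x None) \<odot> y" by (simp add: minus_left minus_right assoc)
  also have "\<dots> = y" using l by (simp add: one_left)
  finally show ?thesis by blast
qed

end

section \<open>The ring structure of skew polynomials\<close>

text \<open>Every polynomial is a sum of monomials. The ring laws of \<open>skew_mult\<close>
  thereby reduce to computations with monomials.\<close>

lemma additive_poly_eqI:
  fixes F G :: "'a::comm_monoid_add poly \<Rightarrow> 'b::comm_monoid_add"
  assumes F: "F 0 = 0" "\<And>x y. F (x + y) = F x + F y" and G: "G 0 = 0" "\<And>x y. G (x + y) = G x + G y"
    and monom: "\<And>a i. F (monom a i) = G (monom a i)"
  shows "F p = G p"
proof -
  have "F (\<Sum>i\<in>I. monom (coeff p i) i) = G (\<Sum>i\<in>I. monom (coeff p i) i)" for I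
    by (induction I rule: infinite_finite_induct) (simp_all add: F G monom)
  from this[of "{..degree p}"] show ?thesis by (simp only: poly_as_sum_of_monoms)
qed

locale skew_ring =
  fixes \<sigma> :: "'a::division_ring \<Rightarrow> 'a"
  assumes aut: "ring_automorphism \<sigma>"
begin

abbreviation skew_times :: "'a poly \<Rightarrow> 'a poly \<Rightarrow> 'a poly" (infixl "\<otimes>" 70) where
  "f \<otimes> g \<equiv> skew_mult \<sigma> f g"

lemma aut_add [simp]: "(\<sigma> ^^ i) (x + y) = (\<sigma> ^^ i) x + (\<sigma> ^^ i) y"
  and aut_mult [simp]: "(\<sigma> ^^ i) (x * y) = (\<sigma> ^^ i) x * (\<sigma> ^^ i) y"
  and aut_one [simp]: "(\<sigma> ^^ i) 1 = 1"
  using aut by (induction i) (simp_all add: ring_automorphism_def)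

lemma aut_0 [simp]: "(\<sigma> ^^ i) 0 = 0"
  using aut_add[of i 0 0] by simp

lemma aut_eq_0_iff [simp]: "(\<sigma> ^^ i) x = 0 \<longleftrightarrow> x = 0"
proof
  assume "(\<sigma> ^^ i) x = 0"
  then have "(\<sigma> ^^ i) (x * inverse x) = 0" by (simp only: aut_mult mult_zero_left)
  then show "x = 0" by (cases "x = 0") auto
qed simp

text \<open>Gives several products the same summation ranges, as the distributive laws require: the
  degree of a sum may be smaller than those of its terms.\<close>

lemma skew_mult_bounded:
  assumes "degree f \<le> m" "degree g \<le> n"
  shows "f \<otimes> g = (\<Sum>i\<le>m. \<Sum>j\<le>n. monom (coeff f i * (\<sigma> ^^ i) (coeff g j)) (i + j))"
proof -
  have "f \<otimes> g = (\<Sum>i\<le>degree f. \<Sum>j\<le>n. monom (coeff f i * (\<sigma> ^^ i) (coeff g j)) (i + j))"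
    unfolding skew_mult_def
    by (rule sum.cong[OF refl], rule sum.mono_neutral_left) (use assms in \<open>auto simp: coeff_eq_0\<close>)
  also have "\<dots> = (\<Sum>i\<le>m. \<Sum>j\<le>n. monom (coeff f i * (\<sigma> ^^ i) (coeff g j)) (i + j))"
    by (rule sum.mono_neutral_left) (use assms in \<open>auto simp: coeff_eq_0\<close>)
  finally show ?thesis .
qed

lemma skew_distrib_right: "(f + g) \<otimes> h = f \<otimes> h + g \<otimes> h"
proof -
  define m where "m = max (degree f) (degree g)"
  have "degree (f + g) \<le> m" "degree f \<le> m" "degree g \<le> m"
    by (auto simp: m_def degree_add_le_max)
  then show ?thesis
    by (simp add: skew_mult_bounded[where m = m and n = "degree h"] distrib_right
        add_monom[symmetric] sum.distrib)
qed

lemma skew_distrib_left: "f \<otimes> (g + h) = f \<otimes> g + f \<otimes> h"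
proof -
  define m where "m = max (degree g) (degree h)"
  have "degree (g + h) \<le> m" "degree g \<le> m" "degree h \<le> m"
    by (auto simp: m_def degree_add_le_max)
  then show ?thesis
    by (simp add: skew_mult_bounded[where m = "degree f" and n = m] distrib_left
        add_monom[symmetric] sum.distrib)
qed

lemma skew_zero [simp]: "0 \<otimes> f = 0" "f \<otimes> 0 = 0"
  by (simp_all add: skew_mult_def)

lemma monom_mult_monom: "monom a i \<otimes> monom b j = monom (a * (\<sigma> ^^ i) b) (i + j)"
proof -
  have "monom a i \<otimes> monom b j =
      (\<Sum>k\<le>i. \<Sum>l\<le>j. monom (coeff (monom a i) k * (\<sigma> ^^ k) (coeff (monom b j) l)) (k + l))"
    by (rule skew_mult_bounded) (auto simp: degree_monom_le)
  also have "\<dots> = (\<Sum>k\<le>i. if k = i then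
      (\<Sum>l\<le>j. if l = j then monom (a * (\<sigma> ^^ i) b) (i + j) else 0) else 0)"
    by (intro sum.cong refl, split if_split, intro conjI impI sum.cong sum.neutral refl) auto
  finally show ?thesis by simp
qed

text \<open>Both sides are additive in each argument, and on monomials both have coefficient a
  \<sigma>^i(b) \<sigma>^(i+j)(c).\<close>

lemma skew_assoc: "(f \<otimes> g) \<otimes> h = f \<otimes> (g \<otimes> h)"
proof (rule additive_poly_eqI[of "\<lambda>f. (f \<otimes> g) \<otimes> h" "\<lambda>f. f \<otimes> (g \<otimes> h)"])
  fix a i
  show "(monom a i \<otimes> g) \<otimes> h = monom a i \<otimes> (g \<otimes> h)"
  proof (rule additive_poly_eqI[of "\<lambda>g. (monom a i \<otimes> g) \<otimes> h" "\<lambda>g. monom a i \<otimes> (g \<otimes> h)"])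
    fix b j
    show "(monom a i \<otimes> monom b j) \<otimes> h = monom a i \<otimes> (monom b j \<otimes> h)"
    proof (rule additive_poly_eqI[of "\<lambda>h. (monom a i \<otimes> monom b j) \<otimes> h"
          "\<lambda>h. monom a i \<otimes> (monom b j \<otimes> h)"])
      show "(monom a i \<otimes> monom b j) \<otimes> monom c k = monom a i \<otimes> (monom b j \<otimes> monom c k)" for c k
        by (simp add: monom_mult_monom mult.assoc funpow_add add.assoc)
    qed (simp_all add: skew_distrib_left)
  qed (simp_all add: skew_distrib_left skew_distrib_right)
qed (simp_all add: skew_distrib_right)

lemma skew_one_left: "[:1:] \<otimes> f = f"
proof (rule additive_poly_eqI[of "\<lambda>f. [:1:] \<otimes> f" "\<lambda>f. f"])
  show "[:1:] \<otimes> monom a i = monom a i" for a i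
    using monom_mult_monom[of 1 0 a i] by (simp add: monom_0)
qed (simp_all add: skew_distrib_left)

lemma skew_one_right: "f \<otimes> [:1:] = f"
proof (rule additive_poly_eqI[of "\<lambda>f. f \<otimes> [:1:]" "\<lambda>f. f"])
  show "monom a i \<otimes> [:1:] = monom a i" for a i
    using monom_mult_monom[of a i 1 0] by (simp add: monom_0)
qed (simp_all add: skew_distrib_right)

lemma coeff_monom_mult:
  "coeff (monom a i \<otimes> g) k = (if i \<le> k then a * (\<sigma> ^^ i) (coeff g (k - i)) else 0)"
proof (rule additive_poly_eqI[of "\<lambda>g. coeff (monom a i \<otimes> g) k"
      "\<lambda>g. if i \<le> k then a * (\<sigma> ^^ i) (coeff g (k - i)) else 0"])
  show "coeff (monom a i \<otimes> monom b j) k =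
      (if i \<le> k then a * (\<sigma> ^^ i) (coeff (monom b j) (k - i)) else 0)" for b j
    by (auto simp: monom_mult_monom)
qed (simp_all add: skew_distrib_left distrib_left)

lemma degree_skew_mult_le: "degree (f \<otimes> g) \<le> degree f + degree g"
  unfolding skew_mult_def
  by (intro degree_sum_le) (auto intro!: order_trans[OF degree_monom_le] add_mono)

text \<open>As powers of \<open>\<sigma>\<close> send only 0 to 0, this yields both the absence of
  zero divisors and the exact degree of a product.\<close>

lemma coeff_skew_mult_top:
  "coeff (f \<otimes> g) (degree f + degree g) = lead_coeff f * (\<sigma> ^^ degree f) (lead_coeff g)"
proof -
  have "coeff (f \<otimes> g) (degree f + degree g) = (\<Sum>i\<le>degree f. if i = degree f then
      (\<Sum>j\<le>degree g. if j = degree g then lead_coeff f * (\<sigma> ^^ degree f) (lead_coeff g) else 0) else 0)"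
    unfolding skew_mult_def coeff_sum
    by (intro sum.cong refl) (auto intro!: sum.cong sum.neutral)
  then show ?thesis by simp
qed

lemma skew_mult_eq_0_iff [simp]: "f \<otimes> g = 0 \<longleftrightarrow> f = 0 \<or> g = 0"
  using coeff_skew_mult_top[of f g] by auto

lemma degree_skew_mult: "f \<noteq> 0 \<Longrightarrow> g \<noteq> 0 \<Longrightarrow> degree (f \<otimes> g) = degree f + degree g"
  using coeff_skew_mult_top[of f g] degree_skew_mult_le[of f g]
  by (intro antisym le_degree) auto

sublocale R: mult_domain "skew_mult \<sigma>" "[:1:]"
  by unfold_locales
    (simp_all add: skew_assoc skew_distrib_left skew_distrib_right skew_one_left skew_one_right)

section \<open>One-sided multiples and central constants\<close>

lemma left_multiples_iff: "x \<in> left_multiples \<sigma> g \<longleftrightarrow> (\<exists>q. x = q \<otimes> g)"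
  by (auto simp: left_multiples_def)

lemma right_multiples_iff: "x \<in> right_multiples \<sigma> g \<longleftrightarrow> (\<exists>q. x = g \<otimes> q)"
  by (auto simp: right_multiples_def)

lemma left_multiples_sum:
  "(\<And>i. i \<in> I \<Longrightarrow> x i \<in> left_multiples \<sigma> f) \<Longrightarrow> (\<Sum>i\<in>I. x i) \<in> left_multiples \<sigma> f"
proof (induction I rule: infinite_finite_induct)
  case (insert i I)
  then show ?case by (auto simp: left_multiples_iff) (metis skew_distrib_right)
qed (auto simp: left_multiples_iff intro: exI[of _ 0])

text \<open>Embeds \<open>K\<close> into the center of \<open>R\<close>; this later makes the map
  induced on \<open>D\<close> linear over \<open>K\<close>.\<close>

lemma constant_central:
  assumes "k \<in> center (*) \<inter> invariants \<sigma>"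
  shows "[:k:] \<otimes> f = f \<otimes> [:k:]"
proof (rule additive_poly_eqI[of "\<lambda>f. [:k:] \<otimes> f" "\<lambda>f. f \<otimes> [:k:]"])
  have "(\<sigma> ^^ i) k = k" for i using assms by (induction i) (auto simp: invariants_def)
  moreover have "k * a = a * k" for a using assms by (auto simp: center_def)
  ultimately show "[:k:] \<otimes> monom a i = monom a i \<otimes> [:k:]" for a i
    using monom_mult_monom[of k 0 a i] monom_mult_monom[of a i k 0] by (simp add: monom_0)
qed (simp_all add: skew_distrib_left skew_distrib_right)

lemma const_mult_const: "[:a:] \<otimes> [:b:] = [:a * b:]"
  using monom_mult_monom[of a 0 b 0] by (simp add: monom_0)

end

section \<open>Generators of twosided ideals\<close>

lemma mult_domain_division_ring: "mult_domain ((*) :: 'a::division_ring \<Rightarrow> 'a \<Rightarrow> 'a) 1"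
  by unfold_locales (auto simp: algebra_simps)

context skew_ring
begin

text \<open>
  For \<open>g\<close> with \<open>g R \<subseteq> R g\<close>, the equation \<open>g x = \<phi> x g\<close> defines an injective degree-preserving
  endomorphism \<open>\<phi>\<close> of \<open>R\<close>. Its restriction to \<open>D\<close> is linear over \<open>K\<close>, hence onto \<open>D\<close>; since
  \<open>\<phi> X\<close> has degree 1, \<open>X\<close> is in the image as well.
\<close>

lemma left_multiples_subset_right_multiples:
  assumes rank: "has_rank (*) (center (*) \<inter> invariants \<sigma>) m"
    and g: "g \<noteq> 0" "right_multiples \<sigma> g \<subseteq> left_multiples \<sigma> g"
  shows "left_multiples \<sigma> g \<subseteq> right_multiples \<sigma> g"
proof -
  interpret D: mult_domain "(*) :: 'a \<Rightarrow> 'a \<Rightarrow> 'a" 1 by (rule mult_domain_division_ring)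
  define K where "K = center (*) \<inter> invariants \<sigma>"
  have Kc: "k * x = x * k" and Ks: "\<sigma> k = k" if "k \<in> K" for k x
    using that by (auto simp: K_def center_def invariants_def)
  have s: "\<sigma> (x + y) = \<sigma> x + \<sigma> y" "\<sigma> (x * y) = \<sigma> x * \<sigma> y" "\<sigma> 0 = 0" "\<sigma> 1 = 1" for x y
    using aut_add[of 1] aut_mult[of 1] aut_0[of 1] aut_one[of 1] by simp_all
  have s': "\<sigma> (x - y) = \<sigma> x - \<sigma> y" for x y
    using s(1)[of "x - y" y] by simp
  have K: "D.central_subring K"
    using D.central_subring_center
    by (auto simp: K_def D.central_subring_def invariants_def s s')
  have K_inv: "\<exists>l\<in>K. l * k = 1" if k: "k \<in> K" "k \<noteq> 0" for k
  proof
    have "inverse k * x = x * inverse k" for x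
    proof -
      have "inverse k * x = inverse k * (x * k) * inverse k" using k(2) by (simp add: mult.assoc)
      also have "\<dots> = x * inverse k" using k(2) by (simp flip: Kc[OF k(1)] mult.assoc)
      finally show ?thesis .
    qed
    moreover have "\<sigma> (inverse k) = inverse k"
      using s(2)[of "inverse k" k] k by (simp add: s(4) Ks) (metis inverse_unique inverse_inverse_eq
        left_inverse mult.assoc mult_1_right right_inverse)
    ultimately show "inverse k \<in> K" by (auto simp: K_def center_def invariants_def)
    show "inverse k * k = 1" using k by simp
  qed
  have "\<exists>y. g \<otimes> x = y \<otimes> g" for x
    using g(2) unfolding left_multiples_def right_multiples_def by blast
  then obtain \<Phi> where \<Phi>: "\<And>x. g \<otimes> x = \<Phi> x \<otimes> g" by metis
  \<comment> \<open>Right cancellation of \<open>g\<close> makes its defining equation determine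
    \<open>\<Phi>\<close>, so the homomorphism laws are checked on that equation.\<close>
  have \<Phi>_eqI: "\<Phi> x = y" if "g \<otimes> x = y \<otimes> g" for x y
    using that \<Phi> g(1) R.right_cancel by metis
  have \<Phi>_add: "\<Phi> (x + y) = \<Phi> x + \<Phi> y" for x y
    by (rule \<Phi>_eqI) (simp add: skew_distrib_left skew_distrib_right \<Phi>)
  have \<Phi>_mult: "\<Phi> (x \<otimes> y) = \<Phi> x \<otimes> \<Phi> y" for x y
    by (rule \<Phi>_eqI) (metis \<Phi> skew_assoc)
  have \<Phi>_0: "\<Phi> x = 0 \<longleftrightarrow> x = 0" for x
    using \<Phi>[of x] g(1) by (metis skew_mult_eq_0_iff)
  have \<Phi>_deg: "degree (\<Phi> x) = degree x" for x
  proof (cases "x = 0")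
    case False
    then show ?thesis using arg_cong[OF \<Phi>[of x], of degree] g(1) by (simp add: degree_skew_mult \<Phi>_0)
  qed (simp add: iffD2[OF \<Phi>_0])
  \<comment> \<open>Since \<open>\<Phi>\<close> preserves degrees, it maps constants to
    constants.\<close>
  define \<phi> where "\<phi> a = coeff (\<Phi> [:a:]) 0" for a
  have \<phi>: "\<Phi> [:a:] = [:\<phi> a:]" for a
    using \<Phi>_deg[of "[:a:]"] by (auto simp: \<phi>_def elim: degree_eq_zeroE)
  have \<phi>_onto: "\<exists>a. \<phi> a = b" for b
  proof (rule D.injective_linear_imp_surjective[OF K K_inv])
    show "has_rank (*) K m" using rank by (simp add: K_def)
    show "\<phi> (x + y) = \<phi> x + \<phi> y" for x y
      using \<Phi>_add[of "[:x:]" "[:y:]"] by (simp add: \<phi>)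
    show "\<phi> (k * x) = k * \<phi> x" if "k \<in> K" for k x
    proof -
      have "\<Phi> [:k:] = [:k:]"
        by (rule \<Phi>_eqI) (use that in \<open>simp add: constant_central K_def\<close>)
      then show ?thesis using \<Phi>_mult[of "[:k:]" "[:x:]"] by (simp add: \<phi> const_mult_const)
    qed
    show "x = 0" if "\<phi> x = 0" for x
      using \<Phi>_0[of "[:x:]"] that by (simp add: \<phi>)
  qed auto
  define X :: "'a poly" where "X = monom 1 1"
  have "degree X = 1" "X \<noteq> 0" by (simp_all add: X_def degree_monom_eq monom_eq_0_iff)
  then have dX: "degree (\<Phi> X) = 1" using \<Phi>_deg by simp
  define a b where "a = coeff (\<Phi> X) 1" and "b = coeff (\<Phi> X) 0"
  have "a \<noteq> 0" using dX by (metis a_def leading_coeff_neq_0 degree_0 zero_neq_one)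
  have X': "\<Phi> X = [:a:] \<otimes> X + [:b:]"
  proof (rule poly_eqI)
    fix n
    have c: "coeff ([:a:] \<otimes> X) n = a * coeff X n"
      using coeff_monom_mult[of a 0 X n] by (simp add: monom_0)
    consider "n = 0" | "n = 1" | "n > 1" by linarith
    then show "coeff (\<Phi> X) n = coeff ([:a:] \<otimes> X + [:b:]) n"
      by cases (use c dX in \<open>simp_all add: a_def b_def X_def coeff_eq_0\<close>)
  qed
  \<comment> \<open>The image is closed under sums and products. It contains the constants, hence
    also \<open>X\<close>, by solving \<open>\<Phi> X = [:a:] \<otimes> X + [:b:]\<close>, and
    therefore all of \<open>R\<close>.\<close>
  define T where "T = range \<Phi>"
  have T_add: "x + y \<in> T" if "x \<in> T" "y \<in> T" for x y
    using that by (auto simp: T_def simp flip: \<Phi>_add)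
  have T_mult: "x \<otimes> y \<in> T" if "x \<in> T" "y \<in> T" for x y
    using that by (auto simp: T_def simp flip: \<Phi>_mult)
  have T_const: "[:c:] \<in> T" for c
    using \<phi>_onto[of c] by (auto simp: T_def simp flip: \<phi>)
  have "[:inverse a:] \<otimes> (\<Phi> X + [:- b:]) \<in> T"
    by (intro T_mult T_add T_const) (simp add: T_def)
  also have "[:inverse a:] \<otimes> (\<Phi> X + [:- b:]) = X"
  proof -
    have "\<Phi> X + [:- b:] = [:a:] \<otimes> X" by (simp add: X' add.assoc)
    then show ?thesis
      using \<open>a \<noteq> 0\<close> by (simp add: const_mult_const skew_one_left flip: skew_assoc)
  qed
  finally have T_X: "X \<in> T" .
  have T_monom: "monom c i \<in> T" for c i
  proof (induction i)
    case (Suc i)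
    then show ?case using T_mult[OF Suc T_X] monom_mult_monom[of c i 1 1] by (simp add: X_def)
  qed (simp add: monom_0 T_const)
  have "(\<Sum>i\<in>I. monom (coeff p i) i) \<in> T" if "finite I" for p I
    using that T_const[of 0] by (induction I) (simp_all add: T_add T_monom)
  from this[of "{..degree p}" p for p] have T: "p \<in> T" for p
    by (simp only: poly_as_sum_of_monoms finite_atMost)
  show ?thesis
  proof
    fix x assume "x \<in> left_multiples \<sigma> g"
    then obtain q where q: "x = q \<otimes> g" by (auto simp: left_multiples_iff)
    obtain y where "q = \<Phi> y" using T[of q] by (auto simp: T_def)
    then show "x \<in> right_multiples \<sigma> g" using q \<Phi>[of y, symmetric] by (auto simp: right_multiples_iff)
  qed
qed

end

section \<open>Correctness and cost of the schoolbook arithmetic\<close>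

lemma length_coeffs_le: "length (coeffs p) \<le> Suc (degree p)"
  by (cases "p = 0") (simp_all add: length_coeffs)

locale costed_skew_ring = skew_ring \<sigma> for \<sigma> :: "'a::division_ring \<Rightarrow> 'a" +
  fixes \<kappa> :: "'a op_costs" and s m \<iota> a :: nat
  assumes costs: "costs_bounded_by \<kappa> s m \<iota> a"
begin

abbreviation unit_cost :: nat where "unit_cost \<equiv> s + m + a"

lemma add_cost_le: "add_cost \<kappa> x y \<le> s"
  and mult_cost_le: "mult_cost \<kappa> x y \<le> m"
  and inv_cost_le: "x \<noteq> 0 \<Longrightarrow> inv_cost \<kappa> x \<le> \<iota>"
  and aut_cost_le: "aut_cost \<kappa> j x \<le> a"
  using costs by (auto simp: costs_bounded_by_def)

section \<open>Operations on coefficient lists\<close>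

lemma scaled_row_correct:
  "scaled_row \<sigma> \<kappa> c j bs = (row, t) \<Longrightarrow>
     row = map (\<lambda>b. c * (\<sigma> ^^ j) b) bs \<and> t \<le> length bs * (m + a)"
proof (induction bs arbitrary: row t)
  case (Cons b bs)
  obtain row' t' where r: "scaled_row \<sigma> \<kappa> c j bs = (row', t')" by fastforce
  show ?case
    using Cons.IH[OF r] Cons.prems r aut_cost_le[of j b] mult_cost_le[of c "(\<sigma> ^^ j) b"]
    by (auto simp: Let_def)
qed simp

text \<open>\<open>nth_default 0\<close> pads with zeros, so lists of different lengths can be
  compared. Only the overlap is charged; this lets the length of either summand alone bound the
  cost.\<close>

lemma aligned_add_correct:
  "shifted_add \<kappa> 0 xs ys = (zs, t) \<Longrightarrow>
     (\<forall>k. nth_default 0 zs k = nth_default 0 xs k + nth_default 0 ys k) \<and>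
     t \<le> min (length xs) (length ys) * s"
proof (induction xs arbitrary: ys zs t)
  case (Cons x xs)
  show ?case
  proof (cases ys)
    case (Cons y ys')
    obtain zs' t' where r: "shifted_add \<kappa> 0 xs ys' = (zs', t')" by fastforce
    show ?thesis
      using Cons.IH[OF r] Cons.prems r Cons add_cost_le[of x y]
      by (auto simp: nth_default_Cons split: nat.split)
  qed (use Cons.prems in auto)
qed auto

text \<open>The charge does not involve the accumulator \<open>xs\<close>: one row of a
  multiplication or division is paid for by the length of the fixed factor.\<close>

lemma shifted_add_correct:
  "shifted_add \<kappa> j xs ys = (zs, t) \<Longrightarrow>
     (\<forall>k. nth_default 0 zs k =
       nth_default 0 xs k + (if j \<le> k then nth_default 0 ys (k - j) else 0)) \<and>
     t \<le> length ys * s"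
proof (induction j arbitrary: xs zs t)
  case 0
  then have "t \<le> min (length xs) (length ys) * s" using aligned_add_correct by blast
  also have "\<dots> \<le> length ys * s" by (intro mult_le_mono) auto
  finally show ?case using aligned_add_correct[OF 0] by simp
next
  case (Suc j)
  \<comment> \<open>Using \<open>tl\<close> treats the empty and the nonempty list alike, since both
    recursive equations continue with the tail.\<close>
  obtain zs' t' where r: "shifted_add \<kappa> j (tl xs) ys = (zs', t')" by fastforce
  show ?case
    using Suc.IH[OF r] Suc.prems r
    by (cases xs) (auto simp: nth_default_Cons split: nat.split)
qed

lemma poly_add_correct:
  assumes "poly_add \<kappa> f g = (h, t)"
  shows "h = f + g" "t \<le> Suc (degree f) * s"
proof -
  obtain zs where r: "shifted_add \<kappa> 0 (coeffs f) (coeffs g) = (zs, t)" "h = Poly zs"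
    using assms by (auto simp: poly_add_def split: prod.splits)
  note add = aligned_add_correct[OF r(1)]
  show "h = f + g"
    by (rule poly_eqI) (use add in \<open>simp add: r(2) nth_default_coeffs_eq\<close>)
  have "t \<le> min (length (coeffs f)) (length (coeffs g)) * s" using add by blast
  also have "\<dots> \<le> Suc (degree f) * s"
    using length_coeffs_le[of f] by (intro mult_le_mono) auto
  finally show "t \<le> Suc (degree f) * s" .
qed

lemma add_scaled_correct:
  assumes "add_scaled \<sigma> \<kappa> p c j g = (h, t)"
  shows "h = p + monom c j \<otimes> g" "t \<le> Suc (degree g) * unit_cost"
proof -
  obtain row t1 zs t2 where r: "scaled_row \<sigma> \<kappa> c j (coeffs g) = (row, t1)"
    "shifted_add \<kappa> j (coeffs p) row = (zs, t2)" "h = Poly zs" "t = t1 + t2"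
    using assms by (auto simp: add_scaled_def split: prod.splits)
  note row = scaled_row_correct[OF r(1)] and add = shifted_add_correct[OF r(2)]
  have "nth_default 0 row k = c * (\<sigma> ^^ j) (coeff g k)" for k
    using row nth_default_map_eq[of "\<lambda>b. c * (\<sigma> ^^ j) b" 0 0 "coeffs g" k]
    by (simp add: nth_default_coeffs_eq)
  then show "h = p + monom c j \<otimes> g"
    using add by (intro poly_eqI) (simp add: r(3) nth_default_coeffs_eq coeff_monom_mult)
  have "t \<le> length (coeffs g) * unit_cost"
    using row add r(4) by (simp add: algebra_simps)
  also have "\<dots> \<le> Suc (degree g) * unit_cost"
    using length_coeffs_le[of g] by (rule mult_le_mono1)
  finally show "t \<le> Suc (degree g) * unit_cost" .
qed

lemma mult_loop_correct:
  "mult_loop \<sigma> \<kappa> acc j bs g = (h, t) \<Longrightarrow>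
     h = acc + (\<Sum>l<length bs. monom (bs ! l) (j + l)) \<otimes> g \<and>
     t \<le> length bs * (Suc (degree g) * unit_cost)"
proof (induction bs arbitrary: acc j h t)
  case (Cons b bs)
  obtain acc' t1 where r1: "add_scaled \<sigma> \<kappa> acc b j g = (acc', t1)" by fastforce
  obtain h' t2 where r2: "mult_loop \<sigma> \<kappa> acc' (Suc j) bs g = (h', t2)" by fastforce
  have "(\<Sum>l<length (b # bs). monom ((b # bs) ! l) (j + l)) =
      monom b j + (\<Sum>l<length bs. monom (bs ! l) (Suc j + l))"
    unfolding length_Cons sum.lessThan_Suc_shift by simp
  then show ?case
    using Cons.IH[OF r2] Cons.prems r1 r2 add_scaled_correct[OF r1]
    by (simp add: skew_distrib_right add.assoc)
qed simp

section \<open>Multiplication and left division of polynomials\<close>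

lemma poly_mult_correct:
  assumes "poly_mult \<sigma> \<kappa> f g = (h, t)"
  shows "h = f \<otimes> g" "t \<le> Suc (degree f) * Suc (degree g) * unit_cost"
proof -
  have r: "h = (\<Sum>l<length (coeffs f). monom (coeffs f ! l) l) \<otimes> g"
    "t \<le> length (coeffs f) * (Suc (degree g) * unit_cost)"
    using mult_loop_correct[of 0 0 "coeffs f" g h t] assms by (simp_all add: poly_mult_def)
  have "(\<Sum>l<length (coeffs f). monom (coeffs f ! l) l) = f"
  proof (cases "f = 0")
    case False
    then have "(\<Sum>l<length (coeffs f). monom (coeffs f ! l) l) = (\<Sum>l\<le>degree f. monom (coeff f l) l)"
      by (simp add: length_coeffs lessThan_Suc_atMost coeffs_nth del: sum.lessThan_Suc sum.atMost_Suc)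
    then show ?thesis by (simp add: poly_as_sum_of_monoms)
  qed simp
  then show "h = f \<otimes> g" using r(1) by simp
  show "t \<le> Suc (degree f) * Suc (degree g) * unit_cost"
    unfolding mult.assoc using r(2) mult_le_mono1[OF length_coeffs_le] by (rule order_trans)
qed

text \<open>Each round cancels the coefficient of X^(deg g + j). Degrees are expressed by vanishing
  coefficients, so that the zero polynomial is no special case. Beyond the row of
  \<open>degree g + 1\<close> entries, one further unit per round pays for the quotient
  coefficient.\<close>

lemma div_loop_correct:
  assumes "g \<noteq> 0"
  shows "div_loop \<sigma> \<kappa> (inverse (lead_coeff g)) g j f = ((q, \<rho>), t) \<Longrightarrow>
     (\<forall>k\<ge>degree g + j. coeff f k = 0) \<Longrightarrow>
     f = q \<otimes> g + \<rho> \<and> (\<forall>k\<ge>degree g. coeff \<rho> k = 0) \<and> (\<forall>k\<ge>j. coeff q k = 0) \<and>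
     t \<le> j * (Suc (Suc (degree g)) * unit_cost)"
proof (induction j arbitrary: f q \<rho> t)
  case (Suc j)
  define u where "u = inverse (lead_coeff g)"
  define b where "b = coeff f (degree g + j)"
  define c where "c = b * (\<sigma> ^^ j) u"
  obtain f' t1 where r1: "add_scaled \<sigma> \<kappa> f (- c) j g = (f', t1)" by fastforce
  obtain q' \<rho>' t2 where r2: "div_loop \<sigma> \<kappa> u g j f' = ((q', \<rho>'), t2)" by (metis surj_pair)
  have res: "q = monom c j + q'" "\<rho> = \<rho>'"
    "t = aut_cost \<kappa> j u + mult_cost \<kappa> b ((\<sigma> ^^ j) u) + t1 + t2"
    using Suc.prems(1) r1 r2 by (simp_all add: u_def[symmetric] b_def[symmetric] c_def[symmetric] Let_def)
  note f' = add_scaled_correct[OF r1]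
  \<comment> \<open>\<open>u\<close> inverts the leading coefficient of \<open>g\<close>, so its
    image under \<sigma>^j inverts the image of that coefficient.\<close>
  have "c * (\<sigma> ^^ j) (lead_coeff g) = b"
    using assms aut_mult[of j u "lead_coeff g"] by (simp add: c_def u_def mult.assoc del: aut_mult)
  then have "coeff f' k = 0" if "k \<ge> degree g + j" for k
    using that Suc.prems(2)
    by (cases "k = degree g + j") (auto simp: f'(1) coeff_monom_mult b_def coeff_eq_0)
  then have IH: "f' = q' \<otimes> g + \<rho>'" "\<forall>k\<ge>degree g. coeff \<rho>' k = 0" "\<forall>k\<ge>j. coeff q' k = 0"
    "t2 \<le> j * (Suc (Suc (degree g)) * unit_cost)"
    using Suc.IH[OF r2[unfolded u_def]] by auto
  have "f = monom c j \<otimes> g + f'"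
    by (simp add: f'(1) minus_monom[symmetric] R.minus_left)
  then have "f = q \<otimes> g + \<rho>" by (simp add: IH(1) res skew_distrib_right add.assoc)
  moreover have "t \<le> Suc j * (Suc (Suc (degree g)) * unit_cost)"
    using IH(4) f'(2) aut_cost_le[of j u] mult_cost_le[of b "(\<sigma> ^^ j) u"] by (simp add: res(3))
  ultimately show ?case using IH by (simp add: res)
qed simp

text \<open>The cost is split by cases because dividing a shorter polynomial is free, even of an
  inversion; Algorithm A may begin with such a division.\<close>

lemma poly_div_correct:
  assumes "poly_div \<sigma> \<kappa> f g = ((q, \<rho>), t)" "g \<noteq> 0"
  shows "f = q \<otimes> g + \<rho>" "\<rho> = 0 \<or> degree \<rho> < degree g"
    "degree q \<le> degree f - degree g"
    "degree g \<le> degree f \<Longrightarrow>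
      t \<le> \<iota> + Suc (degree f - degree g) * (Suc (Suc (degree g)) * unit_cost)"
    "degree f < degree g \<Longrightarrow> q = 0 \<and> \<rho> = f \<and> t = 0"
proof -
  have main: "f = q \<otimes> g + \<rho> \<and> (\<rho> = 0 \<or> degree \<rho> < degree g) \<and> degree q \<le> degree f - degree g \<and>
      t \<le> \<iota> + Suc (degree f - degree g) * (Suc (Suc (degree g)) * unit_cost)"
    if deg: "degree g \<le> degree f"
  proof -
    obtain t' where r: "div_loop \<sigma> \<kappa> (inverse (lead_coeff g)) g (Suc (degree f - degree g)) f = ((q, \<rho>), t')"
      "t = inv_cost \<kappa> (lead_coeff g) + t'"
      using assms(1) deg by (auto simp: poly_div_def Let_def split: prod.splits)
    have "\<forall>k\<ge>degree g + Suc (degree f - degree g). coeff f k = 0"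
      using deg by (auto simp: coeff_eq_0)
    note d = div_loop_correct[OF assms(2) r(1) this]
    have "degree q \<le> degree f - degree g" by (rule degree_le) (use d in auto)
    moreover have "\<rho> = 0 \<or> degree \<rho> < degree g"
      using d leading_coeff_0_iff[of \<rho>] by (metis not_le)
    ultimately show ?thesis using d r(2) inv_cost_le[of "lead_coeff g"] assms(2) by auto
  qed
  have triv: "q = 0 \<and> \<rho> = f \<and> t = 0" if "degree f < degree g"
    using assms(1) that by (simp add: poly_div_def)
  show "f = q \<otimes> g + \<rho>" "\<rho> = 0 \<or> degree \<rho> < degree g" "degree q \<le> degree f - degree g"
    using main triv by (cases "degree g \<le> degree f"; auto)+
  show "t \<le> \<iota> + Suc (degree f - degree g) * (Suc (Suc (degree g)) * unit_cost)"
    if "degree g \<le> degree f"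
    using main that by blast
  show "q = 0 \<and> \<rho> = f \<and> t = 0" if "degree f < degree g" by (rule triv) fact
qed

end

section \<open>The Euclidean algorithm\<close>

context costed_skew_ring
begin

lemma euclid_step_correct:
  assumes "f1 \<noteq> 0"
  obtains c \<rho> t' where
    "euclid_step \<sigma> \<kappa> (f0, f1, v0, v1, t) = (f1, \<rho>, v1, v0 - c \<otimes> v1, t')"
    "f0 = c \<otimes> f1 + \<rho>" "\<rho> = 0 \<or> degree \<rho> < degree f1" "degree c \<le> degree f0 - degree f1"
    "degree f0 < degree f1 \<Longrightarrow> c = 0"
    "t' \<le> t + (if degree f0 < degree f1 then 0
       else \<iota> + Suc (degree f0 - degree f1) * (Suc (Suc (degree f1)) * unit_cost)) +
       Suc (degree f0 - degree f1) * Suc (degree v1) * unit_cost + Suc (degree v0) * unit_cost"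
proof -
  obtain c \<rho> t1 where r1: "poly_div \<sigma> \<kappa> f0 f1 = ((c, \<rho>), t1)" by (metis surj_pair)
  obtain p t2 where r2: "poly_mult \<sigma> \<kappa> c v1 = (p, t2)" by fastforce
  obtain v t3 where r3: "poly_add \<kappa> v0 (- p) = (v, t3)" by fastforce
  note d = poly_div_correct[OF r1 assms] and p = poly_mult_correct[OF r2]
    and v = poly_add_correct[OF r3]
  show thesis
  proof (rule that)
    show "euclid_step \<sigma> \<kappa> (f0, f1, v0, v1, t) = (f1, \<rho>, v1, v0 - c \<otimes> v1, t + t1 + t2 + t3)"
      using r1 r2 r3 v(1) p(1) by simp
    have "t1 \<le> (if degree f0 < degree f1 then 0
       else \<iota> + Suc (degree f0 - degree f1) * (Suc (Suc (degree f1)) * unit_cost))"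
      using d(4,5) by auto
    moreover have "t2 \<le> Suc (degree f0 - degree f1) * Suc (degree v1) * unit_cost"
      using p(2) d(3) by (meson Suc_le_mono mult_le_mono1 order_trans)
    moreover have "t3 \<le> Suc (degree v0) * unit_cost"
      using v(2) by (rule order_trans) (intro mult_le_mono2, simp)
    ultimately show "t + t1 + t2 + t3 \<le> t + (if degree f0 < degree f1 then 0
       else \<iota> + Suc (degree f0 - degree f1) * (Suc (Suc (degree f1)) * unit_cost)) +
       Suc (degree f0 - degree f1) * Suc (degree v1) * unit_cost + Suc (degree v0) * unit_cost"
      by linarith
  qed (use d in blast)+
qed

text \<open>
  The last conjunct says that the pairs \<open>(u\<^sub>0, v\<^sub>0), (u\<^sub>1, v\<^sub>1)\<close> of cofactors, of which only
  the second entries are computed, span \<open>R \<times> R\<close>.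
\<close>

definition cofactor_inv :: "'a poly \<Rightarrow> 'a poly \<Rightarrow> 'a euclid_state \<Rightarrow> bool" where
  "cofactor_inv f h = (\<lambda>(f0, f1, v0, v1, t).
     (\<exists>u. f0 = u \<otimes> f + v0 \<otimes> h) \<and> (\<exists>u. f1 = u \<otimes> f + v1 \<otimes> h) \<and>
     (\<forall>q g. \<exists>x y. g = x \<otimes> v0 + y \<otimes> v1 \<and> q \<otimes> f + g \<otimes> h = x \<otimes> f0 + y \<otimes> f1))"

section \<open>Invariance and meaning of the cofactors\<close>

lemma cofactor_inv_init: "cofactor_inv f h (f, h, 0, [:1:], t)"
  unfolding cofactor_inv_def prod.case
proof (intro conjI allI)
  show "\<exists>u. f = u \<otimes> f + 0 \<otimes> h" by (rule exI[of _ "[:1:]"]) (simp add: skew_one_left)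
  show "\<exists>u. h = u \<otimes> f + [:1:] \<otimes> h" by (rule exI[of _ 0]) (simp add: skew_one_left)
  show "\<exists>x y. g = x \<otimes> 0 + y \<otimes> [:1:] \<and> q \<otimes> f + g \<otimes> h = x \<otimes> f + y \<otimes> h" for q g
    by (rule exI[of _ q], rule exI[of _ g]) (simp add: skew_one_right)
qed

lemma cofactor_inv_step:
  assumes "cofactor_inv f h (f0, f1, v0, v1, t)" "f0 = c \<otimes> f1 + \<rho>"
  shows "cofactor_inv f h (f1, \<rho>, v1, v0 - c \<otimes> v1, t')"
  unfolding cofactor_inv_def prod.case
proof (intro conjI allI)
  obtain u0 u1 where u: "f0 = u0 \<otimes> f + v0 \<otimes> h" "f1 = u1 \<otimes> f + v1 \<otimes> h"
    using assms(1) by (auto simp: cofactor_inv_def)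
  then show "\<exists>u. f1 = u \<otimes> f + v1 \<otimes> h" by blast
  have "\<rho> = f0 - c \<otimes> f1" using assms(2) by simp
  also have "\<dots> = (u0 - c \<otimes> u1) \<otimes> f + (v0 - c \<otimes> v1) \<otimes> h"
    unfolding u by (simp add: R.diff_left skew_distrib_left skew_assoc)
  finally show "\<exists>u. \<rho> = u \<otimes> f + (v0 - c \<otimes> v1) \<otimes> h" by blast
  fix q g
  obtain x y where xy: "g = x \<otimes> v0 + y \<otimes> v1" "q \<otimes> f + g \<otimes> h = x \<otimes> f0 + y \<otimes> f1"
    using assms(1) unfolding cofactor_inv_def prod.case by blast
  \<comment> \<open>Substituting \<open>v0 = c \<otimes> v1 + (v0 - c \<otimes> v1)\<close> turns
    the coefficients \<open>x, y\<close> into \<open>x \<otimes> c + y, x\<close>; the remainders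
    transform in the same way.\<close>
  have "g = (x \<otimes> c + y) \<otimes> v1 + x \<otimes> (v0 - c \<otimes> v1)"
    by (simp add: xy(1) skew_distrib_right R.diff_right skew_assoc)
  moreover have "q \<otimes> f + g \<otimes> h = (x \<otimes> c + y) \<otimes> f1 + x \<otimes> \<rho>"
    by (simp add: xy(2) assms(2) skew_distrib_right skew_distrib_left skew_assoc)
  ultimately show "\<exists>x y. g = x \<otimes> v1 + y \<otimes> (v0 - c \<otimes> v1) \<and> q \<otimes> f + g \<otimes> h = x \<otimes> f1 + y \<otimes> \<rho>"
    by blast
qed

text \<open>At the end the second pair is a relation
  \<open>u \<otimes> f + v \<otimes> h = 0\<close>, so multiples of \<open>v\<close> annihilate.
  Conversely, expanding any relation in the two pairs leaves \<open>x \<otimes> f0 = 0\<close>, so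
  only a multiple of \<open>v\<close> remains.\<close>

lemma cofactor_inv_final:
  assumes "cofactor_inv f h (f0, 0, v0, v, t)" "f0 \<noteq> 0"
  shows "g \<otimes> h \<in> left_multiples \<sigma> f \<longleftrightarrow> g \<in> left_multiples \<sigma> v"
proof
  assume "g \<otimes> h \<in> left_multiples \<sigma> f"
  then obtain q where q: "g \<otimes> h = q \<otimes> f" by (auto simp: left_multiples_iff)
  obtain x y where xy: "g = x \<otimes> v0 + y \<otimes> v" "(- q) \<otimes> f + g \<otimes> h = x \<otimes> f0 + y \<otimes> 0"
    using assms(1) unfolding cofactor_inv_def prod.case by blast
  have "x \<otimes> f0 = 0" using xy(2) by (simp only: q R.minus_left) simp
  then have "x = 0" using assms(2) by simp
  then show "g \<in> left_multiples \<sigma> v" using xy(1) by (auto simp: left_multiples_iff)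
next
  assume "g \<in> left_multiples \<sigma> v"
  then obtain x where x: "g = x \<otimes> v" by (auto simp: left_multiples_iff)
  obtain u where "0 = u \<otimes> f + v \<otimes> h" using assms(1) by (auto simp: cofactor_inv_def)
  then have "v \<otimes> h = (- u) \<otimes> f" by (simp add: R.minus_left eq_neg_iff_add_eq_0 add.commute)
  then have "g \<otimes> h = (x \<otimes> (- u)) \<otimes> f" by (simp add: x skew_assoc)
  then show "g \<otimes> h \<in> left_multiples \<sigma> f" by (auto simp: left_multiples_iff)
qed

text \<open>
  Each later step costs at most \<open>\<iota> + 8 (N + 1) (s + m + a)\<close> per unit by which it lowers the
  degree of \<open>f\<^sub>0\<close>, so that degree serves as a potential for the cost.
\<close>

definition step_weight :: "nat \<Rightarrow> nat" where
  "step_weight N = \<iota> + 8 * Suc N * unit_cost"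

text \<open>Cofactors gain in degree what the remainders lose, which keeps both degree sums below
  \<open>N\<close>. \<open>T\<close> is a fixed budget for the cost so far plus the
  potential.\<close>

definition degree_inv :: "nat \<Rightarrow> nat \<Rightarrow> 'a euclid_state \<Rightarrow> bool" where
  "degree_inv N T = (\<lambda>(f0, f1, v0, v1, t).
     f0 \<noteq> 0 \<and> v1 \<noteq> 0 \<and> degree v0 \<le> degree v1 \<and> (f1 \<noteq> 0 \<longrightarrow> degree f1 < degree f0) \<and>
     degree v0 + degree f1 \<le> N \<and> degree v1 + degree f0 \<le> N \<and>
     t + degree f0 * step_weight N \<le> T)"

text \<open>\<open>\<Delta>\<close> is the drop in the degree of \<open>f0\<close>. As
  \<open>Suc \<Delta> \<le> 2 * \<Delta>\<close>, division, product and addition take at most 4, 2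
  and 1 times \<open>\<Delta> * (Suc N * p)\<close>, which the factor 8 covers.\<close>

lemma step_cost_le:
  assumes "0 < \<Delta>" "k \<le> N" "l \<le> N" "l' \<le> N"
  shows "\<iota> + Suc \<Delta> * (Suc (Suc k) * p) + Suc \<Delta> * Suc l * p + Suc l' * p
    \<le> \<Delta> * (\<iota> + 8 * Suc N * (p::nat))"
proof -
  define w where "w = \<Delta> * (Suc N * p)"
  have D: "Suc \<Delta> \<le> 2 * \<Delta>" using assms(1) by simp
  have "Suc \<Delta> * (Suc (Suc k) * p) \<le> (2 * \<Delta>) * ((2 * Suc N) * p)"
    by (intro mult_le_mono D) (use assms in simp_all)
  moreover have "Suc \<Delta> * (Suc l * p) \<le> (2 * \<Delta>) * (Suc N * p)"
    by (intro mult_le_mono D) (use assms in simp_all)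
  moreover have "1 * (Suc l' * p) \<le> \<Delta> * (Suc N * p)"
    by (intro mult_le_mono) (use assms in simp_all)
  moreover have "\<iota> \<le> \<Delta> * \<iota>" using assms(1) by simp
  moreover have "(2 * \<Delta>) * ((2 * Suc N) * p) = 4 * w" "(2 * \<Delta>) * (Suc N * p) = 2 * w"
    "\<Delta> * (\<iota> + 8 * Suc N * p) = \<Delta> * \<iota> + 8 * w"
    by (simp_all add: w_def algebra_simps)
  ultimately show ?thesis unfolding w_def[symmetric] mult.assoc[of "Suc \<Delta>"] by linarith
qed

text \<open>Here \<open>k\<close> is the smaller and \<open>\<Delta>\<close> the difference of the
  two input degrees. The 14 splits as 2 for a possible exchange step, 2 for the division, 1 each for
  product and addition, and 8 for the potential.\<close>

lemma initial_cost_le: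
  assumes "k \<le> N" "k \<le> H" "Suc \<Delta> * Suc k \<le> Suc N * Suc H"
  shows "2 * p + (\<iota> + Suc \<Delta> * (Suc (Suc k) * p)) + Suc \<Delta> * p + p + k * (\<iota> + 8 * Suc N * p)
    \<le> Suc N * \<iota> + 14 * (Suc N * Suc H * (p::nat))"
proof -
  define w where "w = Suc N * Suc H * p"
  have sum: "2 * p + (\<iota> + x) + y + p + (u + 8 * z) \<le> v + 14 * w"
    if "x \<le> 2 * w" "y \<le> w" "p \<le> w" "z \<le> w" "\<iota> + u \<le> v" for x y z u v :: nat
    using that by linarith
  have "Suc \<Delta> * Suc k * p \<le> w" unfolding w_def by (rule mult_le_mono1) fact
  then have "Suc \<Delta> * (Suc (Suc k) * p) \<le> 2 * w" "Suc \<Delta> * p \<le> w"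
    by (simp_all add: algebra_simps)
  moreover have "p \<le> w" by (simp add: w_def)
  moreover have "k * (Suc N * p) \<le> w"
    using mult_le_mono1[of k "Suc H" "Suc N * p"] assms(2) by (simp add: w_def algebra_simps)
  moreover have "\<iota> + k * \<iota> \<le> Suc N * \<iota>" using mult_le_mono1[OF assms(1), of \<iota>] by simp
  moreover have "k * (\<iota> + 8 * Suc N * p) = k * \<iota> + 8 * (k * (Suc N * p))"
    by (simp only: distrib_left mult.left_commute mult.assoc)
  ultimately show ?thesis unfolding w_def[symmetric] by (simp only: sum)
qed

lemma degree_inv_step:
  assumes inv: "degree_inv N T (f0, f1, v0, v1, t)" and "f1 \<noteq> 0"
    and div: "f0 = c \<otimes> f1 + \<rho>" "\<rho> = 0 \<or> degree \<rho> < degree f1" "degree c \<le> degree f0 - degree f1"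
    and t': "t' \<le> t + (\<iota> + Suc (degree f0 - degree f1) * (Suc (Suc (degree f1)) * unit_cost)) +
       Suc (degree f0 - degree f1) * Suc (degree v1) * unit_cost + Suc (degree v0) * unit_cost"
  shows "degree_inv N T (f1, \<rho>, v1, v0 - c \<otimes> v1, t')"
proof -
  have i: "f0 \<noteq> 0" "v1 \<noteq> 0" "degree v0 \<le> degree v1" "degree f1 < degree f0"
    "degree v0 + degree f1 \<le> N" "degree v1 + degree f0 \<le> N" "t + degree f0 * step_weight N \<le> T"
    using inv \<open>f1 \<noteq> 0\<close> by (auto simp: degree_inv_def)
  have "degree \<rho> \<le> degree f1" using div(2) by auto
  \<comment> \<open>The remainder is too short to reach the degree of \<open>f0\<close>, so
    \<open>c \<otimes> f1\<close> must; this fixes the degree of \<open>c\<close>.\<close>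
  have "degree f0 \<le> max (degree (c \<otimes> f1)) (degree \<rho>)"
    unfolding div(1) by (rule degree_add_le_max)
  then have d: "degree f0 \<le> degree (c \<otimes> f1)" using i(4) \<open>degree \<rho> \<le> degree f1\<close> by simp
  have "c \<noteq> 0" using d i(4) by auto
  then have "degree f0 \<le> degree c + degree f1" using d \<open>f1 \<noteq> 0\<close> by (simp add: degree_skew_mult)
  then have dc: "degree c + degree f1 = degree f0" using div(3) i(4) by simp
  have dcv: "degree (c \<otimes> v1) = degree c + degree v1"
    using \<open>c \<noteq> 0\<close> i(2) by (simp add: degree_skew_mult)
  \<comment> \<open>\<open>c\<close> has positive degree, so \<open>c \<otimes> v1\<close> is
    strictly longer than \<open>v0\<close> and its leading term survives.\<close>
  have "degree (v0 - c \<otimes> v1) = degree (- (c \<otimes> v1) + v0)" by simp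
  also have "\<dots> = degree (- (c \<otimes> v1))"
    by (rule degree_add_eq_left) (use dcv dc i in simp)
  finally have dv: "degree (v0 - c \<otimes> v1) = degree c + degree v1" by (simp add: dcv)
  have cost: "t' \<le> t + (degree f0 - degree f1) * step_weight N"
    using step_cost_le[of "degree f0 - degree f1" "degree f1" N "degree v1" "degree v0" unit_cost] i t'
    by (simp add: step_weight_def)
  have "degree f0 * step_weight N = (degree f0 - degree f1) * step_weight N + degree f1 * step_weight N"
    using i(4) by (simp flip: add_mult_distrib)
  then have "t' + degree f1 * step_weight N \<le> T" using cost i(7) by linarith
  moreover have "v0 - c \<otimes> v1 \<noteq> 0" using dv dc i(4) by (metis add_is_0 degree_0 less_add_same_cancel2 less_numeral_extra(3))
  ultimately show ?thesis
    using \<open>f1 \<noteq> 0\<close> div(2) dv dc i \<open>degree \<rho> \<le> degree f1\<close> by (auto simp: degree_inv_def)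
qed

section \<open>Termination and total cost of Algorithm A\<close>

lemma euclid_loop_correct:
  assumes "cofactor_inv f h st" "degree_inv N T st"
  shows "\<exists>f0 v0 v t. while_option (\<lambda>(f0, f1, v0, v1, t). f1 \<noteq> 0) (euclid_step \<sigma> \<kappa>) st =
      Some (f0, 0, v0, v, t) \<and> cofactor_inv f h (f0, 0, v0, v, t) \<and> degree_inv N T (f0, 0, v0, v, t)"
proof -
  let ?b = "\<lambda>(f0, f1 :: 'a poly, v0, v1, t). f1 \<noteq> 0"
  let ?P = "\<lambda>st. cofactor_inv f h st \<and> degree_inv N T st"
  \<comment> \<open>The successor separates a nonzero constant \<open>f1\<close> from the zero
    polynomial, whose \<open>degree\<close> is 0 as well.\<close>
  let ?m = "\<lambda>(f0, f1, v0, v1, t). if f1 = 0 then 0 else Suc (degree f1)"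
  have step: "?P (euclid_step \<sigma> \<kappa> st) \<and> ?m (euclid_step \<sigma> \<kappa> st) < ?m st" if P: "?P st" "?b st" for st
  proof -
    obtain f0 f1 v0 v1 t where st: "st = (f0, f1, v0, v1, t)" by (cases st)
    have f1: "f1 \<noteq> 0" using P(2) by (simp add: st)
    have "degree f1 < degree f0" using P(1) f1 by (simp add: st degree_inv_def)
    obtain c \<rho> t' where s: "euclid_step \<sigma> \<kappa> (f0, f1, v0, v1, t) = (f1, \<rho>, v1, v0 - c \<otimes> v1, t')"
      "f0 = c \<otimes> f1 + \<rho>" "\<rho> = 0 \<or> degree \<rho> < degree f1" "degree c \<le> degree f0 - degree f1"
      "t' \<le> t + (if degree f0 < degree f1 then 0
         else \<iota> + Suc (degree f0 - degree f1) * (Suc (Suc (degree f1)) * unit_cost)) +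
         Suc (degree f0 - degree f1) * Suc (degree v1) * unit_cost + Suc (degree v0) * unit_cost"
      by (rule euclid_step_correct[OF f1, of f0 v0 v1 t]) blast
    have t': "t' \<le> t + (\<iota> + Suc (degree f0 - degree f1) * (Suc (Suc (degree f1)) * unit_cost)) +
       Suc (degree f0 - degree f1) * Suc (degree v1) * unit_cost + Suc (degree v0) * unit_cost"
      using s(5) \<open>degree f1 < degree f0\<close> by simp
    show ?thesis
      using P(1) cofactor_inv_step[OF _ s(2)] degree_inv_step[OF _ f1 s(2-4) t'] s(3) f1
      unfolding st s(1) by auto
  qed
  obtain st' where st': "while_option ?b (euclid_step \<sigma> \<kappa>) st = Some st'"
    using measure_while_option_Some[where P = ?P and b = ?b and f = ?m, OF step] assms by blast
  moreover have "?P st'"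
    using while_option_rule[where P = ?P, OF _ st'] step assms by blast
  moreover have "\<not> ?b st'" using while_option_stop[OF st'] .
  ultimately show ?thesis by (cases st') auto
qed

text \<open>\<open>degree_inv\<close> is entered after the first genuine division. If
  \<open>f\<close> is shorter than \<open>h\<close>, the first step merely exchanges them and leaves
  \<open>v1 = 0\<close>, so a second step must precede.\<close>

lemma element_annihilator_correct:
  assumes "f \<noteq> 0" "h \<noteq> 0"
  shows "\<exists>v t. element_annihilator \<sigma> \<kappa> f h = Some (v, t) \<and> v \<noteq> 0 \<and> degree v \<le> degree f \<and>
    (\<forall>g. g \<otimes> h \<in> left_multiples \<sigma> f \<longleftrightarrow> g \<in> left_multiples \<sigma> v) \<and>
    t \<le> Suc (degree f) * \<iota> + 14 * (Suc (degree f) * Suc (degree h) * unit_cost)"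
proof -
  define N H where "N = degree f" and "H = degree h"
  define T where "T = Suc N * \<iota> + 14 * (Suc N * Suc H * unit_cost)"
  let ?while = "while_option (\<lambda>(f0, f1, v0, v1, t). f1 \<noteq> 0) (euclid_step \<sigma> \<kappa>)"
  let ?init = "(f, h, 0, [:1:], 0) :: 'a euclid_state"
  obtain c \<rho> t where s: "euclid_step \<sigma> \<kappa> ?init = (h, \<rho>, [:1:], 0 - c \<otimes> [:1:], t)"
    "f = c \<otimes> h + \<rho>" "\<rho> = 0 \<or> degree \<rho> < degree h" "degree c \<le> degree f - degree h"
    "degree f < degree h \<Longrightarrow> c = 0"
    "t \<le> 0 + (if degree f < degree h then 0
       else \<iota> + Suc (degree f - degree h) * (Suc (Suc (degree h)) * unit_cost)) +
       Suc (degree f - degree h) * Suc (degree [:1::'a:]) * unit_cost + Suc (degree (0::'a poly)) * unit_cost"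
    by (rule euclid_step_correct[OF assms(2), of f 0 "[:1:]" 0]) blast
  note s = s[folded N_def H_def]
  have init: "cofactor_inv f h (euclid_step \<sigma> \<kappa> ?init)"
    unfolding s(1) by (rule cofactor_inv_step[OF cofactor_inv_init s(2)])
  have "\<exists>st. ?while (euclid_step \<sigma> \<kappa> ?init) = ?while st \<and> cofactor_inv f h st \<and> degree_inv N T st"
  proof (cases "N < H")
    case False
    have "c \<noteq> 0" using s(2,3) False assms(1) by (auto simp: N_def)
    have "Suc (N - H) * Suc H \<le> Suc N * Suc H" by (rule mult_le_mono1) simp
    then have "t + H * step_weight N \<le> T"
      using initial_cost_le[of H N H "N - H" unit_cost] s(6) False
      by (simp add: T_def step_weight_def)
    then have "degree_inv N T (euclid_step \<sigma> \<kappa> ?init)"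
      using \<open>c \<noteq> 0\<close> s(3,4) False assms
      unfolding s(1) by (auto simp: degree_inv_def skew_one_right N_def H_def)
    then show ?thesis using init by blast
  next
    case True
    obtain c' \<rho>' t' where s': "euclid_step \<sigma> \<kappa> (h, f, [:1:], 0, t) = (f, \<rho>', 0, [:1:] - c' \<otimes> 0, t')"
      "h = c' \<otimes> f + \<rho>'" "\<rho>' = 0 \<or> degree \<rho>' < degree f"
      "t' \<le> t + (if degree h < degree f then 0
         else \<iota> + Suc (degree h - degree f) * (Suc (Suc (degree f)) * unit_cost)) +
         Suc (degree h - degree f) * Suc (degree (0::'a poly)) * unit_cost + Suc (degree [:1::'a:]) * unit_cost"
      by (rule euclid_step_correct[OF assms(1), of h "[:1:]" 0 t]) blast
    note s' = s'[folded N_def H_def]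
    have st: "euclid_step \<sigma> \<kappa> ?init = (h, f, [:1:], 0, t)" using s(1,2,5) True by simp
    have "cofactor_inv f h (euclid_step \<sigma> \<kappa> (h, f, [:1:], 0, t))"
      unfolding s'(1) by (rule cofactor_inv_step[OF init[unfolded st] s'(2)])
    \<comment> \<open>After the exchange the loop condition tests \<open>f\<close>, which is
      nonzero, so this second step is performed by the loop.\<close>
    moreover have "?while (h, f, [:1:], 0, t) = ?while (euclid_step \<sigma> \<kappa> (h, f, [:1:], 0, t))"
      using assms(1) by (subst while_option_unfold) simp
    moreover have "degree_inv N T (euclid_step \<sigma> \<kappa> (h, f, [:1:], 0, t))"
    proof -
      have "Suc (H - N) * Suc N \<le> Suc H * Suc N" by (rule mult_le_mono1) simp
      then have "Suc (H - N) * Suc N \<le> Suc N * Suc H" by (simp only: mult.commute)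
      moreover have "t \<le> 2 * unit_cost" using s(6) True by simp
      ultimately have "t' + N * step_weight N \<le> T"
        using initial_cost_le[of N N H "H - N" unit_cost] s'(4) True
        by (simp add: T_def step_weight_def)
      then show ?thesis
        using s'(3) assms unfolding s'(1) by (auto simp: degree_inv_def N_def)
    qed
    ultimately show ?thesis unfolding st by blast
  qed
  then obtain f0 v0 v t where w: "?while (euclid_step \<sigma> \<kappa> ?init) = Some (f0, 0, v0, v, t)"
    "cofactor_inv f h (f0, 0, v0, v, t)" "degree_inv N T (f0, 0, v0, v, t)"
    using euclid_loop_correct by metis
  have "element_annihilator \<sigma> \<kappa> f h = Some (v, t)"
    using w(1) by (simp only: element_annihilator_def) simp
  moreover have "f0 \<noteq> 0" "v \<noteq> 0" "degree v \<le> N" "t \<le> T"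
    using w(3) by (auto simp: degree_inv_def)
  ultimately show ?thesis
    using cofactor_inv_final[OF w(2)] by (auto simp: N_def H_def T_def)
qed

text \<open>A left multiple \<open>x \<otimes> h\<close> lies in \<open>Rf\<close> exactly when
  \<open>x\<close> is a left multiple of \<open>v\<close>, so \<open>v \<otimes> h\<close> generates
  the intersection. The final product raises 14 to 15.\<close>

lemma left_lcm_correct:
  assumes "f \<noteq> 0" "h \<noteq> 0"
  shows "\<exists>g t. left_lcm \<sigma> \<kappa> f h = Some (g, t) \<and> g \<noteq> 0 \<and> degree g \<le> degree f + degree h \<and>
    left_multiples \<sigma> g = left_multiples \<sigma> f \<inter> left_multiples \<sigma> h \<and>
    t \<le> Suc (degree f) * \<iota> + 15 * (Suc (degree f) * Suc (degree h) * unit_cost)"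
proof -
  obtain v t where v: "element_annihilator \<sigma> \<kappa> f h = Some (v, t)" "v \<noteq> 0" "degree v \<le> degree f"
    "\<And>g. g \<otimes> h \<in> left_multiples \<sigma> f \<longleftrightarrow> g \<in> left_multiples \<sigma> v"
    "t \<le> Suc (degree f) * \<iota> + 14 * (Suc (degree f) * Suc (degree h) * unit_cost)"
    using element_annihilator_correct[OF assms] by blast
  obtain g t' where r: "poly_mult \<sigma> \<kappa> v h = (g, t')" by fastforce
  note g = poly_mult_correct[OF r]
  have "t' \<le> Suc (degree f) * Suc (degree h) * unit_cost"
    by (rule order_trans[OF g(2)]) (intro mult_le_mono, use v(3) in simp_all)
  moreover have "x \<in> left_multiples \<sigma> g \<longleftrightarrow> x \<in> left_multiples \<sigma> f \<inter> left_multiples \<sigma> h" for x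
    using v(4) unfolding g(1) by (auto simp: left_multiples_iff skew_assoc) (metis skew_assoc)+
  moreover have "left_lcm \<sigma> \<kappa> f h = Some (g, t + t')" by (simp add: left_lcm_def v(1) r)
  moreover have "degree g \<le> degree f + degree h" "g \<noteq> 0"
    using degree_skew_mult_le[of v h] v(2,3) assms(2) by (simp_all add: g(1))
  ultimately show ?thesis using v(5) by (intro exI[of _ g] exI[of _ "t + t'"]) auto
qed

section \<open>Computation of a bound\<close>

text \<open>Each pass lengthens \<open>g\<close> by at most \<open>degree f\<close>. Fixing
  \<open>G\<close> in advance as a bound for all passes allows a uniform charge: 14 for the
  annihilator of a generator, 15 for the common multiple, with two sets of inversions.\<close>

lemma bound_loop_correct:
  assumes "f \<noteq> 0" "g \<noteq> 0" "\<forall>c\<in>set cs. c \<noteq> 0 \<and> degree c \<le> d"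
    and "degree g + length cs * degree f \<le> G"
  shows "\<exists>b t. bound_loop \<sigma> \<kappa> f cs g = Some (b, t) \<and> b \<noteq> 0 \<and>
    left_multiples \<sigma> b = left_multiples \<sigma> g \<inter> {x. \<forall>c\<in>set cs. x \<otimes> c \<in> left_multiples \<sigma> f} \<and>
    t \<le> length cs * (2 * (Suc (degree f) * \<iota>) + 14 * (Suc (degree f) * Suc d * unit_cost) +
      15 * (Suc (degree f) * Suc G * unit_cost))"
  using assms(2-)
proof (induction cs arbitrary: g)
  case (Cons c cs)
  have c: "c \<noteq> 0" "degree c \<le> d" using Cons.prems(2) by auto
  obtain fc t1 where 1: "element_annihilator \<sigma> \<kappa> f c = Some (fc, t1)" "fc \<noteq> 0" "degree fc \<le> degree f"
    "\<And>x. x \<otimes> c \<in> left_multiples \<sigma> f \<longleftrightarrow> x \<in> left_multiples \<sigma> fc"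
    "t1 \<le> Suc (degree f) * \<iota> + 14 * (Suc (degree f) * Suc (degree c) * unit_cost)"
    using element_annihilator_correct[OF assms(1) c(1)] by blast
  obtain g' t2 where 2: "left_lcm \<sigma> \<kappa> fc g = Some (g', t2)" "g' \<noteq> 0" "degree g' \<le> degree fc + degree g"
    "left_multiples \<sigma> g' = left_multiples \<sigma> fc \<inter> left_multiples \<sigma> g"
    "t2 \<le> Suc (degree fc) * \<iota> + 15 * (Suc (degree fc) * Suc (degree g) * unit_cost)"
    using left_lcm_correct[OF 1(2) Cons.prems(1)] by blast
  have "degree g' + length cs * degree f \<le> G" using 1(3) 2(3) Cons.prems(3) by simp
  then obtain b t3 where 3: "bound_loop \<sigma> \<kappa> f cs g' = Some (b, t3)" "b \<noteq> 0"
    "left_multiples \<sigma> b = left_multiples \<sigma> g' \<inter> {x. \<forall>c\<in>set cs. x \<otimes> c \<in> left_multiples \<sigma> f}"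
    "t3 \<le> length cs * (2 * (Suc (degree f) * \<iota>) + 14 * (Suc (degree f) * Suc d * unit_cost) +
      15 * (Suc (degree f) * Suc G * unit_cost))"
    using Cons.IH[OF 2(2)] Cons.prems(2) by auto
  have "Suc (degree f) * Suc (degree c) * unit_cost \<le> Suc (degree f) * Suc d * unit_cost"
    by (intro mult_le_mono) (use c(2) in simp_all)
  moreover have "Suc (degree fc) * \<iota> \<le> Suc (degree f) * \<iota>"
    by (intro mult_le_mono) (use 1(3) in simp_all)
  moreover have "Suc (degree fc) * Suc (degree g) * unit_cost \<le> Suc (degree f) * Suc G * unit_cost"
    by (intro mult_le_mono) (use 1(3) Cons.prems(3) in simp_all)
  ultimately have "t1 + t2 \<le> 2 * (Suc (degree f) * \<iota>) + 14 * (Suc (degree f) * Suc d * unit_cost) +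
      15 * (Suc (degree f) * Suc G * unit_cost)"
    using 1(5) 2(5) by linarith
  then have "t1 + t2 + t3 \<le> length (c # cs) * (2 * (Suc (degree f) * \<iota>) +
      14 * (Suc (degree f) * Suc d * unit_cost) + 15 * (Suc (degree f) * Suc G * unit_cost))"
    using 3(4) by (simp only: length_Cons mult_Suc)
  moreover have "bound_loop \<sigma> \<kappa> f (c # cs) g = Some (b, t1 + t2 + t3)"
    using 1(1) 2(1) 3(1) by simp
  moreover have "left_multiples \<sigma> b =
      left_multiples \<sigma> g \<inter> {x. \<forall>c'\<in>set (c # cs). x \<otimes> c' \<in> left_multiples \<sigma> f}"
    using 3(3) 2(4) 1(4) by auto
  ultimately show ?case using 3(2) by blast
qed simp

text \<open>Central coefficients move to the left of \<open>x\<close>, where the left ideal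
  \<open>Rf\<close> absorbs them. The intersection with \<open>Rf\<close> is the condition at the
  element 1.\<close>

lemma annihilator_eq_of_generators:
  assumes "module_generators (skew_mult \<sigma>) (center (skew_mult \<sigma>)) cs"
  shows "quotient_annihilator \<sigma> f =
    left_multiples \<sigma> f \<inter> {x. \<forall>c\<in>set cs. x \<otimes> c \<in> left_multiples \<sigma> f}"
proof (intro set_eqI iffI)
  fix x assume x: "x \<in> quotient_annihilator \<sigma> f"
  then have "x \<otimes> [:1:] \<in> left_multiples \<sigma> f" unfolding quotient_annihilator_def by blast
  then show "x \<in> left_multiples \<sigma> f \<inter> {x. \<forall>c\<in>set cs. x \<otimes> c \<in> left_multiples \<sigma> f}"
    using x by (simp add: skew_one_right quotient_annihilator_def)
next
  fix x assume x: "x \<in> left_multiples \<sigma> f \<inter> {x. \<forall>c\<in>set cs. x \<otimes> c \<in> left_multiples \<sigma> f}"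
  have "x \<otimes> h \<in> left_multiples \<sigma> f" for h
  proof -
    obtain k where k: "\<And>i. i < length cs \<Longrightarrow> k i \<in> center (skew_mult \<sigma>)"
      "h = (\<Sum>i<length cs. k i \<otimes> cs ! i)"
      using assms unfolding module_generators_def by blast
    have "x \<otimes> h = (\<Sum>i<length cs. k i \<otimes> (x \<otimes> cs ! i))"
      unfolding k(2) R.sum_right
    proof (rule sum.cong)
      fix i assume "i \<in> {..<length cs}"
      then have "k i \<otimes> x = x \<otimes> k i" using k(1)[of i] by (simp add: center_def)
      then show "x \<otimes> (k i \<otimes> cs ! i) = k i \<otimes> (x \<otimes> cs ! i)" by (simp flip: skew_assoc)
    qed simp
    also have "\<dots> \<in> left_multiples \<sigma> f"
    proof (rule left_multiples_sum)
      fix i assume "i \<in> {..<length cs}"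
      then have "x \<otimes> cs ! i \<in> left_multiples \<sigma> f" using x by simp
      then show "k i \<otimes> (x \<otimes> cs ! i) \<in> left_multiples \<sigma> f"
        unfolding left_multiples_iff by (metis skew_assoc)
    qed
    finally show ?thesis .
  qed
  then show "x \<in> quotient_annihilator \<sigma> f" by (simp add: quotient_annihilator_def)
qed

lemma compute_bound_correct:
  assumes "f \<noteq> 0" and rank: "has_rank (*) (center (*) \<inter> invariants \<sigma>) \<mu>"
    and R: "has_rank (skew_mult \<sigma>) (center (skew_mult \<sigma>)) (length cs)"
    and gen: "module_generators (skew_mult \<sigma>) (center (skew_mult \<sigma>)) cs"
    and deg: "\<forall>c\<in>set cs. degree c \<le> d"
  shows "\<exists>g t. compute_bound \<sigma> \<kappa> cs f = Some (g, t) \<and> is_bound \<sigma> f g \<and>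
    t \<le> length cs * (2 * (Suc (degree f) * \<iota>) + 14 * (Suc (degree f) * Suc d * unit_cost) +
      15 * (Suc (degree f) * Suc (degree f + length cs * degree f) * unit_cost))"
proof -
  have "\<forall>c\<in>set cs. c \<noteq> 0 \<and> degree c \<le> d"
    using R.generators_nonzero[OF R.central_subring_center R gen] deg by blast
  from bound_loop_correct[OF assms(1,1) this order_refl]
  obtain g t where g: "compute_bound \<sigma> \<kappa> cs f = Some (g, t)" "g \<noteq> 0"
    "left_multiples \<sigma> g = quotient_annihilator \<sigma> f"
    "t \<le> length cs * (2 * (Suc (degree f) * \<iota>) + 14 * (Suc (degree f) * Suc d * unit_cost) +
      15 * (Suc (degree f) * Suc (degree f + length cs * degree f) * unit_cost))"
    unfolding compute_bound_def annihilator_eq_of_generators[OF gen] by blast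
  \<comment> \<open>The annihilator is closed under right multiplication, which gives this
    inclusion; the reverse one comes from the finite rank of \<open>D\<close> over
    \<open>K\<close>.\<close>
  have "right_multiples \<sigma> g \<subseteq> left_multiples \<sigma> g"
  proof
    fix x assume "x \<in> right_multiples \<sigma> g"
    then obtain q where x: "x = g \<otimes> q" by (auto simp: right_multiples_iff)
    have "g \<in> left_multiples \<sigma> g"
      unfolding left_multiples_iff by (metis skew_one_left)
    then show "x \<in> left_multiples \<sigma> g"
      unfolding g(3) by (simp add: quotient_annihilator_def x skew_assoc)
  qed
  moreover from this have "left_multiples \<sigma> g \<subseteq> right_multiples \<sigma> g"
    using left_multiples_subset_right_multiples[OF rank g(2)] by blast
  ultimately have "is_bound \<sigma> f g" using g(3) by (simp add: is_bound_def)
  then show ?thesis using g by blast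
qed

end

text \<open>For \<open>n, r \<ge> 1\<close> one has \<open>Suc n \<le> 2 * n\<close> and
  \<open>Suc (n + r * n) \<le> 3 * (r * n)\<close>, whence 28 = 14 * 2 and 90 = 15 * 2 * 3.
  Additions come out with \<open>r ^ 2\<close>, weakened to \<open>r ^ 3\<close> only at the
  end.\<close>

lemma bound_cost_le:
  fixes r n d s m a \<iota> t :: nat
  assumes "n \<ge> 1" and t: "t \<le> r * (2 * (Suc n * \<iota>) + 14 * (Suc n * Suc d * (s + m + a)) +
    15 * (Suc n * Suc (n + r * n) * (s + m + a)))"
  shows "t \<le> (28 * Suc d + 90) * (r * n * \<iota> + r ^ 3 * n ^ 2 * s + r ^ 2 * n ^ 2 * (m + a))"
proof (cases "r = 0")
  case False
  define p where "p = s + m + a"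
  have n: "Suc n \<le> 2 * n" using assms by simp
  have rn: "n \<le> r * n" using False by simp
  have "2 * (Suc n * \<iota>) \<le> 4 * (n * \<iota>)"
    using mult_le_mono1[OF n, of \<iota>] by simp
  moreover have "14 * (Suc n * Suc d * p) \<le> 28 * Suc d * (r * n ^ 2 * p)"
  proof -
    have "n * 1 \<le> (r * n) * n" by (rule mult_le_mono) (use rn assms in simp_all)
    then have "n \<le> r * n ^ 2" by (simp only: power2_eq_square mult.assoc mult_1_right)
    then have "Suc n \<le> 2 * (r * n ^ 2)" using n by linarith
    then have "Suc n * (Suc d * p) \<le> 2 * (r * n ^ 2) * (Suc d * p)" by (rule mult_le_mono1)
    then show ?thesis by (simp add: algebra_simps)
  qed
  moreover have "15 * (Suc n * Suc (n + r * n) * p) \<le> 90 * (r * n ^ 2 * p)"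
  proof -
    have "Suc (n + r * n) \<le> 3 * (r * n)" using rn assms(1) by linarith
    then have "Suc n * Suc (n + r * n) * p \<le> (2 * n) * (3 * (r * n)) * p"
      by (intro mult_le_mono n) simp_all
    then show ?thesis by (simp add: power2_eq_square algebra_simps)
  qed
  moreover have "4 * (n * \<iota>) \<le> (28 * Suc d + 90) * (n * \<iota>)" by (rule mult_le_mono1) simp
  ultimately have "2 * (Suc n * \<iota>) + 14 * (Suc n * Suc d * p) + 15 * (Suc n * Suc (n + r * n) * p)
      \<le> (28 * Suc d + 90) * (n * \<iota> + r * n ^ 2 * p)"
    unfolding add_mult_distrib2 add_mult_distrib by linarith
  then have "t \<le> r * ((28 * Suc d + 90) * (n * \<iota> + r * n ^ 2 * p))"
    using t unfolding p_def by (meson mult_le_mono2 order_trans)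
  also have "\<dots> = (28 * Suc d + 90) * (r * n * \<iota> + r ^ 2 * n ^ 2 * s + r ^ 2 * n ^ 2 * (m + a))"
    by (simp add: p_def power2_eq_square algebra_simps)
  also have "\<dots> \<le> (28 * Suc d + 90) * (r * n * \<iota> + r ^ 3 * n ^ 2 * s + r ^ 2 * n ^ 2 * (m + a))"
  proof -
    have "r ^ 2 \<le> r ^ 3" using False by (intro power_increasing) simp_all
    then have "r ^ 2 * n ^ 2 * s \<le> r ^ 3 * n ^ 2 * s" by (intro mult_le_mono1)
    then show ?thesis by (intro mult_le_mono2 add_mono order_refl)
  qed
  finally show ?thesis .
qed (use t in simp)

text \<open>The witness for \<open>C\<close> depends on the degree bound \<open>d\<close> alone and
  is thus uniform in \<open>\<sigma>\<close>, \<open>r\<close> and the cost functions. Correctness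
  covers every nonzero \<open>f\<close>; the estimate starts at \<open>n = 1\<close>, because its
  right-hand side is 0 at \<open>n = 0\<close>.\<close>

theorem theorem3p5:
  fixes d :: nat
  assumes "\<exists>m. has_rank ((*) :: 'a::division_ring \<Rightarrow> 'a \<Rightarrow> 'a) (center (*)) m"
  shows "\<exists>C::real. \<forall>(\<sigma> :: 'a \<Rightarrow> 'a) (\<mu>::nat) (r::nat) (cs :: 'a poly list)
           (\<kappa> :: 'a op_costs) (S :: nat \<Rightarrow> nat) (M :: nat \<Rightarrow> nat) (I :: nat \<Rightarrow> nat) (A :: nat \<Rightarrow> nat).
           ring_automorphism \<sigma> \<longrightarrow> finite_order \<sigma> \<longrightarrow>
           has_rank (*) (center (*) \<inter> invariants \<sigma>) \<mu> \<longrightarrow>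
           has_rank (skew_mult \<sigma>) (center (skew_mult \<sigma>)) r \<longrightarrow>
           length cs = r \<longrightarrow> module_generators (skew_mult \<sigma>) (center (skew_mult \<sigma>)) cs \<longrightarrow>
           (\<forall>c\<in>set cs. degree c \<le> d) \<longrightarrow>
           costs_bounded_by \<kappa> (S \<mu>) (M \<mu>) (I \<mu>) (A \<mu>) \<longrightarrow>
           (\<forall>f. f \<noteq> 0 \<longrightarrow>
             (\<exists>g t. compute_bound \<sigma> \<kappa> cs f = Some (g, t) \<and> is_bound \<sigma> f g \<and>
               (let n = degree f in n \<ge> 1 \<longrightarrow>
                 real t \<le> C * real (r * n * I \<mu> + r ^ 3 * n ^ 2 * S \<mu> + r ^ 2 * n ^ 2 * (M \<mu> + A \<mu>)))))"
proof (intro exI[of _ "real (28 * Suc d + 90)"] allI impI, goal_cases)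
  case (1 \<sigma> \<mu> r cs \<kappa> S M I A f)
  interpret costed_skew_ring \<sigma> \<kappa> "S \<mu>" "M \<mu>" "I \<mu>" "A \<mu>"
    by unfold_locales (use 1 in auto)
  obtain g t where g: "compute_bound \<sigma> \<kappa> cs f = Some (g, t)" "is_bound \<sigma> f g"
    "t \<le> r * (2 * (Suc (degree f) * I \<mu>) + 14 * (Suc (degree f) * Suc d * unit_cost) +
      15 * (Suc (degree f) * Suc (degree f + r * degree f) * unit_cost))"
    using compute_bound_correct[of f \<mu> cs d] 1 by blast
  have "real t \<le> real (28 * Suc d + 90) * real (r * n * I \<mu> + r ^ 3 * n ^ 2 * S \<mu> + r ^ 2 * n ^ 2 * (M \<mu> + A \<mu>))"
    if "n = degree f" "n \<ge> 1" for n
    using bound_cost_le[OF that(2), of t r "I \<mu>" d] g(3)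
    unfolding that(1) of_nat_mult[symmetric] of_nat_le_iff by blast
  then show ?case using g(1,2) by (auto simp only: Let_def)
qed
end
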